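(* Let $n\geq2$ and let $X=\mathrm{GL}(n,\mathbb{R})/\mathrm{O}(n)$ be the symmetric space of $\mathrm{GL}(n,\mathbb{R})$, i.e. the space of all Euclidean norms on $\mathbb{R}^n$, endowed with the Finsler length metric $d$ associated to the standard $\ell^\infty$ metric on each maximal flat. Then the injective hull of $X$ is the space $\hat{X}$ of all norms on $\mathbb{R}^n$, with the metric $\hat d(\eta,\eta')=\sup_{v\in\mathbb{R}^n\setminus\{0\}}\left|\log\frac{\eta(v)}{\eta'(v)}\right|$. Moreover, $X$ is cobounded in $\hat{X}$, and $\hat{X}$ is proper. As a consequence, $\mathrm{GL}(n,\mathbb{R})$ acts properly and cocompactly on the injective space $\hat{X}$.
   Context: For a basis $v_1,\dots,v_n$ of $\mathbb{R}^n$, the associated maximal flat of $X$ is $\{\eta_m\mid m\in\mathbb{R}^n\}\simeq\mathbb{R}^n$, with $\eta_m(\sum x_iv_i)=\sqrt{\sum_i e^{2m_i}|x_i|^2}$; the metric $d$ is the $\ell^\infty$ metric on each such flat, and it equals the restriction of $\hat d$ to $X$. The group acts by precomposition of norms. A subset is cobounded if every point of the ambient space is within a uniformly bounded distance of it; a metric space is proper if closed balls are compact. A metric space $(Z,d)$ is injective if for any points $(x_i)_{i\in I}$ and nonnegative reals $(r_i)_{i\in I}$ with $r_i+r_j\geq d(x_i,x_j)$ for all $i,j$, the closed balls $B(x_i,r_i)$ have a common point. The injective hull of a metric space is the (essentially unique) minimal injective metric space into which it embeds isometrically; here the embedding is the inclusion $X\subset\hat X$. *)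

theory Defs
  imports "HOL-Analysis.Analysis" "HOL-Algebra.Group_Action"
begin

section \<open>Norms on \<open>\<real>\<^sup>n\<close>\<close>

definition is_norm :: "(real^'n \<Rightarrow> real) \<Rightarrow> bool" where
  "is_norm \<eta> \<longleftrightarrow>
     (\<forall>v. 0 \<le> \<eta> v) \<and> (\<forall>v. \<eta> v = 0 \<longleftrightarrow> v = 0) \<and>
     (\<forall>a v. \<eta> (a *\<^sub>R v) = \<bar>a\<bar> * \<eta> v) \<and>
     (\<forall>v w. \<eta> (v + w) \<le> \<eta> v + \<eta> w)"

definition is_inner_product :: "(real^'n \<Rightarrow> real^'n \<Rightarrow> real) \<Rightarrow> bool" where
  "is_inner_product b \<longleftrightarrow>
     bilinear b \<and> (\<forall>v w. b v w = b w v) \<and> (\<forall>v. v \<noteq> 0 \<longrightarrow> 0 < b v v)"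

definition all_norms :: "(real^'n \<Rightarrow> real) set" where
  "all_norms = {\<eta>. is_norm \<eta>}"

definition euclidean_norms :: "(real^'n \<Rightarrow> real) set" where
  "euclidean_norms = {\<eta>. \<exists>b. is_inner_product b \<and> \<eta> = (\<lambda>v. sqrt (b v v))}"

text \<open>
  The value 0 outside the set of norms is a convention: the locale \<^locale>\<open>Metric_space\<close> demands
  symmetry and nonnegativity of a distance function on the whole type, not only on the carrier.
\<close>

definition norm_dist :: "(real^'n \<Rightarrow> real) \<Rightarrow> (real^'n \<Rightarrow> real) \<Rightarrow> real" where
  "norm_dist \<eta> \<eta>' =
     (if \<eta> \<in> all_norms \<and> \<eta>' \<in> all_norms then SUP v\<in>-{0}. \<bar>ln (\<eta> v / \<eta>' v)\<bar> else 0)"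

section \<open>The Finsler length metric on Euclidean norms\<close>

definition is_basis :: "('n \<Rightarrow> real^'n) \<Rightarrow> bool" where
  "is_basis v \<longleftrightarrow> inj v \<and> independent (range v) \<and> span (range v) = UNIV"

text \<open>
  The point \<open>\<eta>\<^sub>m\<close> of the maximal flat of the basis \<open>v\<close>;
  \<open>representation (range v) x (v i)\<close> is the coordinate of \<open>x\<close> along \<open>v i\<close>.
\<close>

definition flat :: "('n \<Rightarrow> real^'n) \<Rightarrow> real^'n \<Rightarrow> real^'n \<Rightarrow> real" where
  "flat v m = (\<lambda>x. sqrt (\<Sum>i\<in>UNIV. exp (2 * m $ i) * \<bar>representation (range v) x (v i)\<bar>\<^sup>2))"

text \<open>
  The Gram matrix, in the standard basis, of the inner product inducing a Euclidean norm (by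
  polarization). It identifies the Euclidean norms with the symmetric positive definite
  matrices, an open subset of the vector space of symmetric matrices; this is the global chart
  in which tangent vectors and piecewise \<open>C\<^sup>1\<close> curves are expressed below.
\<close>

definition gram :: "(real^'n \<Rightarrow> real) \<Rightarrow> real^'n^'n" where
  "gram \<eta> = (\<chi> i j. ((\<eta> (axis i 1 + axis j 1))\<^sup>2 - (\<eta> (axis i 1))\<^sup>2 - (\<eta> (axis j 1))\<^sup>2) / 2)"

text \<open>
  Every tangent vector \<open>S\<close> at \<open>\<eta>\<close> is tangent to some maximal flat through \<open>\<eta>\<close>, i.e. it is the
  velocity at \<open>t = 0\<close> of a line \<open>t \<mapsto> \<eta>\<^bsub>m + t a\<^esub>\<close> in that flat. Its Finsler norm is the
  \<open>\<ell>\<^sup>\<infinity>\<close> norm of \<open>a\<close>, which does not depend on the flat.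
\<close>

definition finsler_norm :: "(real^'n \<Rightarrow> real) \<Rightarrow> real^'n^'n \<Rightarrow> real" where
  "finsler_norm \<eta> S =
     (THE r. \<exists>v m a. is_basis v \<and> \<eta> = flat v m \<and>
        ((\<lambda>t. gram (flat v (m + t *\<^sub>R a))) has_vector_derivative S) (at 0) \<and>
        r = infnorm a)"

text \<open>
  \<open>path_length c L\<close>: \<open>c\<close> restricted to \<open>[0,1]\<close> is a piecewise \<open>C\<^sup>1\<close> curve of Euclidean norms
  (\<^const>\<open>valid_path\<close> is piecewise \<open>C\<^sup>1\<close> on \<open>[0,1]\<close>) of finite Finsler length \<open>L\<close>. The finitely many
  points where \<open>c\<close> is not differentiable do not affect the integral.
\<close>

definition path_length :: "(real \<Rightarrow> real^'n \<Rightarrow> real) \<Rightarrow> real \<Rightarrow> bool" where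
  "path_length c L \<longleftrightarrow>
     (\<forall>t\<in>{0..1}. c t \<in> euclidean_norms) \<and> valid_path (\<lambda>t. gram (c t)) \<and>
     ((\<lambda>t. finsler_norm (c t) (vector_derivative (\<lambda>s. gram (c s)) (at t))) has_integral L) {0..1}"

definition finsler_dist :: "(real^'n \<Rightarrow> real) \<Rightarrow> (real^'n \<Rightarrow> real) \<Rightarrow> real" where
  "finsler_dist \<xi> \<xi>' =
     (if \<xi> \<in> euclidean_norms \<and> \<xi>' \<in> euclidean_norms
      then Inf {L. \<exists>c. c 0 = \<xi> \<and> c 1 = \<xi>' \<and> path_length c L} else 0)"

section \<open>Injective metric spaces and injective hulls\<close>

text \<open>
  A family of points \<open>x\<^sub>i\<close> and radii \<open>r\<^sub>i\<close> is given by the set of its pairs \<open>(x\<^sub>i, r\<^sub>i)\<close>, since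
  hypothesis and conclusion only depend on that set. The empty family makes injective
  spaces nonempty.
\<close>

definition injective_metric_space :: "'a set \<Rightarrow> ('a \<Rightarrow> 'a \<Rightarrow> real) \<Rightarrow> bool" where
  "injective_metric_space Z d \<longleftrightarrow>
     Metric_space Z d \<and>
     (\<forall>F \<subseteq> Z \<times> {0..}. (\<forall>(x, r)\<in>F. \<forall>(y, s)\<in>F. d x y \<le> r + s) \<longrightarrow>
        (\<exists>z\<in>Z. \<forall>(x, r)\<in>F. z \<in> Metric_space.mcball Z d x r))"

definition injective_hull ::
  "'a set \<Rightarrow> ('a \<Rightarrow> 'a \<Rightarrow> real) \<Rightarrow> ('a \<Rightarrow> 'b) \<Rightarrow> 'b set \<Rightarrow> ('b \<Rightarrow> 'b \<Rightarrow> real) \<Rightarrow> bool" where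
  "injective_hull X d e E d' \<longleftrightarrow>
     Metric_space X d \<and> injective_metric_space E d' \<and>
     e ` X \<subseteq> E \<and> (\<forall>x\<in>X. \<forall>y\<in>X. d' (e x) (e y) = d x y) \<and>
     (\<forall>Y. e ` X \<subseteq> Y \<and> Y \<subseteq> E \<and> injective_metric_space Y d' \<longrightarrow> Y = E)"

definition cobounded :: "'a set \<Rightarrow> 'a set \<Rightarrow> ('a \<Rightarrow> 'a \<Rightarrow> real) \<Rightarrow> bool" where
  "cobounded A Z d \<longleftrightarrow> A \<subseteq> Z \<and> (\<exists>C. \<forall>z\<in>Z. \<exists>a\<in>A. d z a \<le> C)"

definition proper_metric_space :: "'a set \<Rightarrow> ('a \<Rightarrow> 'a \<Rightarrow> real) \<Rightarrow> bool" where
  "proper_metric_space Z d \<longleftrightarrow>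
     Metric_space Z d \<and>
     (\<forall>x\<in>Z. \<forall>r. compactin (Metric_space.mtopology Z d) (Metric_space.mcball Z d x r))"

section \<open>The general linear group and its action\<close>

definition GL :: "(real^'n^'n) monoid" where
  "GL = \<lparr>carrier = {A. invertible A}, mult = (**), one = mat 1\<rparr>"

definition GL_topology :: "(real^'n^'n) topology" where
  "GL_topology = top_of_set (carrier GL)"

text \<open>
  Precomposition with the inverse, which makes it a left action. The restriction to norms is what
  \<^locale>\<open>group_action\<close> requires.
\<close>

definition GL_act :: "real^'n^'n \<Rightarrow> (real^'n \<Rightarrow> real) \<Rightarrow> (real^'n \<Rightarrow> real)" where
  "GL_act A = (\<lambda>\<eta>\<in>all_norms. \<lambda>v. \<eta> (matrix_inv A *v v))"

definition isometric_action ::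
  "('g, 'm) monoid_scheme \<Rightarrow> 'a set \<Rightarrow> ('a \<Rightarrow> 'a \<Rightarrow> real) \<Rightarrow> ('g \<Rightarrow> 'a \<Rightarrow> 'a) \<Rightarrow> bool" where
  "isometric_action G Z d \<phi> \<longleftrightarrow>
     group_action G Z \<phi> \<and> (\<forall>g\<in>carrier G. \<forall>x\<in>Z. \<forall>y\<in>Z. d (\<phi> g x) (\<phi> g y) = d x y)"

text \<open>
  Proper action of a topological group in the sense of Bourbaki: the action map is continuous and
  \<open>(g, x) \<mapsto> (g x, x)\<close> is a proper map.
\<close>

definition proper_action :: "'g topology \<Rightarrow> 'a topology \<Rightarrow> ('g \<Rightarrow> 'a \<Rightarrow> 'a) \<Rightarrow> bool" where
  "proper_action T X \<phi> \<longleftrightarrow>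
     continuous_map (prod_topology T X) X (\<lambda>(g, x). \<phi> g x) \<and>
     proper_map (prod_topology T X) (prod_topology X X) (\<lambda>(g, x). (\<phi> g x, x))"

definition cocompact_action ::
  "('g, 'm) monoid_scheme \<Rightarrow> 'a topology \<Rightarrow> ('g \<Rightarrow> 'a \<Rightarrow> 'a) \<Rightarrow> bool" where
  "cocompact_action G X \<phi> \<longleftrightarrow>
     (\<exists>K. compactin X K \<and> (\<Union>g\<in>carrier G. \<phi> g ` K) = topspace X)"

end

theory Submission
  imports Defs "HOL-Complex_Analysis.Great_Picard"
begin

text \<open>
  A norm has distance at most \<open>r\<close> from \<open>\<eta>\<close> iff it lies between \<open>exp (- r) \<eta>\<close> and \<open>exp r \<eta>\<close>, so the
  supremum of the norms \<open>exp (- r\<^sub>i) \<eta>\<^sub>i\<close> is a common point of pairwise compatible balls: the space of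
  norms is injective. For minimality, an injective \<open>Y\<close> containing the Euclidean norms contains, for
  every norm \<open>\<eta>\<close>, some \<open>\<zeta>\<close> at most as far as \<open>\<eta>\<close> from each Euclidean norm, and \<open>\<zeta> = \<eta>\<close> because
  thin ellipsoids inside and slab-like ellipsoids around the unit ball of \<open>\<eta>\<close> test both inequalities
  between \<open>\<zeta>\<close> and \<open>\<eta>\<close> at any given vector.

  The Finsler metric agrees with the restricted metric: the logarithm of \<open>c t x\<close> along a path \<open>c\<close>
  changes at most at the rate of the Finsler norm of the velocity, and the line in a flat through two
  Euclidean norms (simultaneous diagonalization) has length equal to their distance.

  Coboundedness and cocompactness come from Auerbach bases, and properness of the space from the
  Arzela-Ascoli theorem.
\<close>

section \<open>Comparison of norms\<close>

text \<open>The common point of balls is built from their lower edges because suprema of norms keep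
  the triangle inequality, whereas infima need not. A supremum of Euclidean norms need not be
  Euclidean, which is why the hull leaves X.

  The obstacle to minimality is that \<open>norm_dist\<close> is the larger of two one-sided
  comparisons: a Euclidean norm that touches \<eta> at a vector from one side carries information
  only once that side decides the distance. Since multiples of Euclidean norms are Euclidean, this
  can always be arranged. An ellipsoid can in general bound \<eta> on one side and touch it at a
  prescribed vector only up to a factor c > 1, so every test ends with c tending to 1.

  The Finsler distance is an infimum over paths, but no variational argument occurs: two Euclidean
  norms always share a flat, and the line in it attains a lower bound that is valid for all
  paths.\<close>

lemma all_norms_iff: "\<eta> \<in> all_norms \<longleftrightarrow> is_norm \<eta>"
  by (simp add: all_norms_def)

lemma is_normI:
  assumes "\<And>v. 0 \<le> \<eta> v" "\<And>v. \<eta> v = 0 \<Longrightarrow> v = 0" "\<And>a v. \<eta> (a *\<^sub>R v) = \<bar>a\<bar> * \<eta> v"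
    "\<And>v w. \<eta> (v + w) \<le> \<eta> v + \<eta> w"
  shows "is_norm \<eta>"
proof -
  have "\<eta> 0 = 0"
    using assms(3)[of 0 0] by simp
  then show ?thesis
    unfolding is_norm_def using assms by auto
qed

context
  fixes \<eta> :: "real^'n \<Rightarrow> real"
  assumes \<eta>: "is_norm \<eta>"
begin

lemma is_norm_nonneg: "0 \<le> \<eta> v"
  and is_norm_eq_0_iff: "\<eta> v = 0 \<longleftrightarrow> v = 0"
  and is_norm_scaleR: "\<eta> (a *\<^sub>R v) = \<bar>a\<bar> * \<eta> v"
  and is_norm_triangle: "\<eta> (v + w) \<le> \<eta> v + \<eta> w"
  using \<eta> by (auto simp: is_norm_def)

lemma is_norm_pos: "v \<noteq> 0 \<Longrightarrow> 0 < \<eta> v"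
  using is_norm_nonneg[of v] is_norm_eq_0_iff[of v] by linarith

lemma is_norm_minus: "\<eta> (- v) = \<eta> v"
  using is_norm_scaleR[of "-1" v] by simp

lemma is_norm_diff_le: "\<bar>\<eta> v - \<eta> w\<bar> \<le> \<eta> (v - w)"
  using is_norm_triangle[of "v - w" w] is_norm_triangle[of "w - v" v] is_norm_minus[of "v - w"]
  by simp

lemma is_norm_sum_le: "finite I \<Longrightarrow> \<eta> (\<Sum>i\<in>I. f i) \<le> (\<Sum>i\<in>I. \<eta> (f i))"
proof (induction I rule: finite_induct)
  case empty
  then show ?case using is_norm_eq_0_iff[of 0] by simp
next
  case (insert i I)
  then show ?case using is_norm_triangle[of "f i" "\<Sum>i\<in>I. f i"] by simp
qed

lemma is_norm_le_euclidean:
  obtains C where "0 < C" "\<And>v. \<eta> v \<le> C * norm v"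
proof
  let ?C = "1 + (\<Sum>i\<in>UNIV. \<eta> (axis i 1))"
  show "0 < ?C"
    by (intro add_pos_nonneg sum_nonneg is_norm_nonneg) simp
  fix v :: "real^'n"
  have "\<eta> v = \<eta> (\<Sum>i\<in>UNIV. (v $ i) *\<^sub>R axis i 1)"
    by (simp add: basis_expansion[of v, unfolded scalar_mult_eq_scaleR])
  also have "\<dots> \<le> (\<Sum>i\<in>UNIV. \<bar>v $ i\<bar> * \<eta> (axis i 1))"
    using is_norm_sum_le[of UNIV "\<lambda>i. (v $ i) *\<^sub>R axis i 1"] by (simp add: is_norm_scaleR)
  also have "\<dots> \<le> (\<Sum>i\<in>UNIV. norm v * \<eta> (axis i 1))"
    by (intro sum_mono mult_right_mono component_le_norm_cart is_norm_nonneg)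
  also have "\<dots> \<le> ?C * norm v"
    by (simp add: sum_distrib_left algebra_simps)
  finally show "\<eta> v \<le> ?C * norm v" .
qed

lemma continuous_on_is_norm: "continuous_on S \<eta>"
proof -
  obtain C where C: "0 < C" "\<And>v. \<eta> v \<le> C * norm v"
    using is_norm_le_euclidean by blast
  have "C-lipschitz_on S \<eta>"
  proof (rule lipschitz_onI)
    show "dist (\<eta> v) (\<eta> w) \<le> C * dist v w" for v w
      using C(2)[of "v - w"] is_norm_diff_le[of v w] by (simp add: dist_norm)
  qed (use C in simp)
  then show ?thesis
    by (rule lipschitz_on_continuous_on)
qed

text \<open>By compactness, \<eta> attains a positive minimum on the Euclidean unit sphere;
  homogeneity extends the bound to all vectors.\<close>

lemma euclidean_le_is_norm:
  obtains c where "0 < c" "\<And>v. c * norm v \<le> \<eta> v"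
proof -
  let ?S = "sphere 0 1 :: (real^'n) set"
  have "axis undefined 1 \<in> ?S" by simp
  then obtain u where u: "u \<in> ?S" "\<forall>v\<in>?S. \<eta> u \<le> \<eta> v"
    using continuous_attains_inf[of ?S \<eta>] continuous_on_is_norm by auto
  show ?thesis
  proof
    show "0 < \<eta> u" using u by (intro is_norm_pos) auto
    fix v :: "real^'n"
    show "\<eta> u * norm v \<le> \<eta> v"
    proof (cases "v = 0")
      case False
      then have "inverse (norm v) *\<^sub>R v \<in> ?S" by simp
      then have "\<eta> u \<le> \<eta> (inverse (norm v) *\<^sub>R v)" using u by blast
      then show ?thesis
        using False by (simp add: is_norm_scaleR field_simps)
    qed (simp add: is_norm_nonneg)
  qed
qed

end

text \<open>Both norms are comparable with the Euclidean one. Normalizing to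
  \<open>1 \<le> D\<close> makes products of such constants dominate their factors and division by
  them harmless.\<close>

lemma is_norm_comparable:
  assumes "is_norm \<eta>" "is_norm \<xi>"
  obtains D where "1 \<le> D" "\<And>v. \<eta> v \<le> D * \<xi> v"
proof -
  obtain C where C: "0 < C" "\<And>v. \<eta> v \<le> C * norm v"
    using is_norm_le_euclidean[OF assms(1)] by blast
  obtain c where c: "0 < c" "\<And>v. c * norm v \<le> \<xi> v"
    using euclidean_le_is_norm[OF assms(2)] by blast
  show ?thesis
  proof
    fix v
    have "\<eta> v \<le> C * norm v" using C by blast
    also have "\<dots> = C / c * (c * norm v)" using c by simp
    also have "\<dots> \<le> C / c * \<xi> v" using c C by (intro mult_left_mono) auto
    also have "\<dots> \<le> max 1 (C / c) * \<xi> v"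
      using is_norm_nonneg[OF assms(2)] by (intro mult_right_mono) auto
    finally show "\<eta> v \<le> max 1 (C / c) * \<xi> v" .
  qed simp
qed

section \<open>The metric on the space of norms\<close>

lemma abs_ln_divide_le_iff:
  fixes a b :: real
  assumes "0 < a" "0 < b"
  shows "\<bar>ln (a / b)\<bar> \<le> r \<longleftrightarrow> a \<le> exp r * b \<and> b \<le> exp r * a"
proof -
  have "\<bar>ln (a / b)\<bar> \<le> r \<longleftrightarrow> ln a \<le> ln (exp r * b) \<and> ln b \<le> ln (exp r * a)"
    using assms by (auto simp: ln_div ln_mult abs_le_iff)
  also have "\<dots> \<longleftrightarrow> a \<le> exp r * b \<and> b \<le> exp r * a"
    using assms by (subst (1 2) ln_le_cancel_iff) auto
  finally show ?thesis .
qed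

lemma bdd_above_norm_dist:
  assumes "is_norm \<eta>" "is_norm \<xi>"
  shows "bdd_above ((\<lambda>v. \<bar>ln (\<eta> v / \<xi> v)\<bar>) ` (- {0}))"
proof -
  obtain D where D: "1 \<le> D" "\<And>v. \<eta> v \<le> D * \<xi> v"
    using is_norm_comparable[OF assms] by blast
  obtain E where E: "1 \<le> E" "\<And>v. \<xi> v \<le> E * \<eta> v"
    using is_norm_comparable[OF assms(2,1)] by blast
  have DE: "exp (ln (D * E)) = D * E" using D(1) E(1) by simp
  have "\<bar>ln (\<eta> v / \<xi> v)\<bar> \<le> ln (D * E)" if "v \<noteq> 0" for v
  proof -
    have pos: "0 < \<eta> v" "0 < \<xi> v" using that assms is_norm_pos by blast+
    have "D \<le> D * E" "E \<le> D * E"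
      using D(1) E(1) by (auto simp: mult_le_cancel_left1 mult_le_cancel_right1)
    then have "D * \<xi> v \<le> D * E * \<xi> v" "E * \<eta> v \<le> D * E * \<eta> v"
      using pos by (auto intro: mult_right_mono)
    then show ?thesis
      using D(2)[of v] E(2)[of v] pos DE by (simp add: abs_ln_divide_le_iff)
  qed
  then show ?thesis by (auto intro!: bdd_aboveI)
qed

lemma norm_dist_le_iff:
  assumes "is_norm \<eta>" "is_norm \<xi>"
  shows "norm_dist \<eta> \<xi> \<le> r \<longleftrightarrow> (\<forall>v. \<eta> v \<le> exp r * \<xi> v \<and> \<xi> v \<le> exp r * \<eta> v)"
proof -
  have "axis undefined (1::real) \<in> - {0 :: real^'n}" by simp
  then have ne: "- {0 :: real^'n} \<noteq> {}" by blast
  have "norm_dist \<eta> \<xi> \<le> r \<longleftrightarrow> (\<forall>v\<in>-{0}. \<bar>ln (\<eta> v / \<xi> v)\<bar> \<le> r)"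
    using assms by (simp add: norm_dist_def all_norms_iff cSUP_le_iff[OF ne bdd_above_norm_dist[OF assms]])
  also have "\<dots> \<longleftrightarrow> (\<forall>v\<in>-{0}. \<eta> v \<le> exp r * \<xi> v \<and> \<xi> v \<le> exp r * \<eta> v)"
    using assms by (intro ball_cong refl abs_ln_divide_le_iff) (auto intro: is_norm_pos)
  also have "\<dots> \<longleftrightarrow> (\<forall>v. \<eta> v \<le> exp r * \<xi> v \<and> \<xi> v \<le> exp r * \<eta> v)"
  proof -
    have "\<eta> 0 = 0" "\<xi> 0 = 0" using assms by (simp_all add: is_norm_eq_0_iff)
    then show ?thesis by (metis ComplI mult_zero_right order_refl singletonD)
  qed
  finally show ?thesis .
qed

lemma norm_dist_ge:
  assumes "is_norm \<eta>" "is_norm \<xi>" "v \<noteq> 0"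
  shows "\<bar>ln (\<eta> v / \<xi> v)\<bar> \<le> norm_dist \<eta> \<xi>"
  using cSUP_upper[OF _ bdd_above_norm_dist[OF assms(1,2)], of v] assms
  by (simp add: norm_dist_def all_norms_iff)

lemma is_norm_le_norm_dist:
  assumes "is_norm \<eta>" "is_norm \<xi>"
  shows "\<eta> v \<le> exp (norm_dist \<eta> \<xi>) * \<xi> v" "\<xi> v \<le> exp (norm_dist \<eta> \<xi>) * \<eta> v"
  using norm_dist_le_iff[OF assms, of "norm_dist \<eta> \<xi>"] by auto

lemma norm_dist_nonneg: "0 \<le> norm_dist \<eta> \<xi>"
proof (cases "is_norm \<eta> \<and> is_norm \<xi>")
  case True
  have "axis undefined (1::real) \<noteq> (0 :: real^'n)" by simp
  then show ?thesis using norm_dist_ge[of \<eta> \<xi>] True by (metis abs_ge_zero order_trans)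
qed (auto simp: norm_dist_def all_norms_iff)

lemma norm_dist_commute: "norm_dist \<eta> \<xi> = norm_dist \<xi> \<eta>"
proof (cases "is_norm \<eta> \<and> is_norm \<xi>")
  case True
  then have "norm_dist \<eta> \<xi> \<le> r \<longleftrightarrow> norm_dist \<xi> \<eta> \<le> r" for r
    by (auto simp: norm_dist_le_iff)
  then show ?thesis by (meson order_antisym order_refl)
qed (auto simp: norm_dist_def all_norms_iff)

lemma Metric_space_norm_dist: "Metric_space all_norms norm_dist"
proof
  fix \<eta> \<xi> \<zeta> :: "real^'n \<Rightarrow> real"
  show "0 \<le> norm_dist \<eta> \<xi>" by (rule norm_dist_nonneg)
  show "norm_dist \<eta> \<xi> = norm_dist \<xi> \<eta>" by (rule norm_dist_commute)
  assume "\<eta> \<in> all_norms" "\<xi> \<in> all_norms"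
  then have norms: "is_norm \<eta>" "is_norm \<xi>" by (auto simp: all_norms_iff)
  have "norm_dist \<eta> \<xi> = 0 \<longleftrightarrow> norm_dist \<eta> \<xi> \<le> 0"
    using norm_dist_nonneg[of \<eta> \<xi>] by linarith
  also have "\<dots> \<longleftrightarrow> \<eta> = \<xi>"
    by (auto simp: norm_dist_le_iff[OF norms] intro: order_antisym)
  finally show "norm_dist \<eta> \<xi> = 0 \<longleftrightarrow> \<eta> = \<xi>" .
  assume "\<zeta> \<in> all_norms"
  then have norm: "is_norm \<zeta>" by (simp add: all_norms_iff)
  have "\<eta> v \<le> exp (norm_dist \<eta> \<xi> + norm_dist \<xi> \<zeta>) * \<zeta> v" for v
  proof -
    have "\<eta> v \<le> exp (norm_dist \<eta> \<xi>) * \<xi> v" by (rule is_norm_le_norm_dist(1)[OF norms])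
    also have "\<dots> \<le> exp (norm_dist \<eta> \<xi>) * (exp (norm_dist \<xi> \<zeta>) * \<zeta> v)"
      using is_norm_le_norm_dist(1)[OF norms(2) norm] by simp
    finally show ?thesis by (simp add: exp_add mult_ac)
  qed
  moreover have "\<zeta> v \<le> exp (norm_dist \<eta> \<xi> + norm_dist \<xi> \<zeta>) * \<eta> v" for v
  proof -
    have "\<zeta> v \<le> exp (norm_dist \<xi> \<zeta>) * \<xi> v" by (rule is_norm_le_norm_dist(2)[OF norms(2) norm])
    also have "\<dots> \<le> exp (norm_dist \<xi> \<zeta>) * (exp (norm_dist \<eta> \<xi>) * \<eta> v)"
      using is_norm_le_norm_dist(2)[OF norms] by simp
    finally show ?thesis by (simp add: exp_add mult_ac)
  qed
  ultimately show "norm_dist \<eta> \<zeta> \<le> norm_dist \<eta> \<xi> + norm_dist \<xi> \<zeta>"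
    by (simp add: norm_dist_le_iff[OF norms(1) norm])
qed

interpretation norms: Metric_space all_norms norm_dist
  by (rule Metric_space_norm_dist)

section \<open>Injectivity\<close>

lemma is_norm_norm: "is_norm norm"
  by (rule is_normI) (auto simp: norm_triangle_ineq)

lemma is_norm_SUP:
  fixes N :: "(real^'n \<Rightarrow> real) set"
  assumes "N \<noteq> {}" and N: "\<And>\<eta>. \<eta> \<in> N \<Longrightarrow> is_norm \<eta>"
    and bdd: "\<And>v. bdd_above ((\<lambda>\<eta>. \<eta> v) ` N)"
  shows "is_norm (\<lambda>v. SUP \<eta>\<in>N. \<eta> v)"
proof -
  have ge: "\<eta> v \<le> (SUP \<eta>\<in>N. \<eta> v)" if "\<eta> \<in> N" for \<eta> v
    using cSUP_upper[OF that bdd] .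
  obtain \<eta>\<^sub>0 where \<eta>\<^sub>0: "\<eta>\<^sub>0 \<in> N" using assms(1) by blast
  show ?thesis
  proof (rule is_normI)
    fix v w :: "real^'n" and a :: real
    show "0 \<le> (SUP \<eta>\<in>N. \<eta> v)"
      using ge[OF \<eta>\<^sub>0, of v] is_norm_nonneg[OF N[OF \<eta>\<^sub>0]] by (meson order_trans)
    show "v = 0" if "(SUP \<eta>\<in>N. \<eta> v) = 0"
      using ge[OF \<eta>\<^sub>0, of v] is_norm_pos[OF N[OF \<eta>\<^sub>0], of v] that by force
    show "(SUP \<eta>\<in>N. \<eta> (v + w)) \<le> (SUP \<eta>\<in>N. \<eta> v) + (SUP \<eta>\<in>N. \<eta> w)"
      using assms(1)
    proof (rule cSUP_least)
      fix \<eta> assume "\<eta> \<in> N"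
      then show "\<eta> (v + w) \<le> (SUP \<eta>\<in>N. \<eta> v) + (SUP \<eta>\<in>N. \<eta> w)"
        using is_norm_triangle[OF N, of \<eta> v w] ge[of \<eta> v] ge[of \<eta> w] by simp
    qed
    have le: "(SUP \<eta>\<in>N. \<eta> (a *\<^sub>R v)) \<le> \<bar>a\<bar> * (SUP \<eta>\<in>N. \<eta> v)" for a v
      using assms(1) by (rule cSUP_least) (simp add: is_norm_scaleR[OF N] ge mult_left_mono)
    show "(SUP \<eta>\<in>N. \<eta> (a *\<^sub>R v)) = \<bar>a\<bar> * (SUP \<eta>\<in>N. \<eta> v)"
    proof (cases "a = 0")
      case True
      have "\<eta> 0 = 0" if "\<eta> \<in> N" for \<eta> using is_norm_eq_0_iff[OF N[OF that]] by simp
      then have "(\<lambda>\<eta>. \<eta> 0) ` N = {0}" using assms(1) by force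
      then show ?thesis using True by simp
    next
      case False
      \<comment> \<open>The reverse inequality is \<open>le\<close> itself, applied to the scalar
        \<open>inverse a\<close> and the vector \<open>a *\<^sub>R v\<close>.\<close>
      then have "\<bar>a\<bar> * (SUP \<eta>\<in>N. \<eta> v) \<le> (SUP \<eta>\<in>N. \<eta> (a *\<^sub>R v))"
        using le[of "inverse a" "a *\<^sub>R v"] by (simp add: field_simps)
      then show ?thesis using le[of a v] by (rule antisym[rotated])
    qed
  qed
qed

lemma is_norm_scale: "is_norm \<eta> \<Longrightarrow> 0 < c \<Longrightarrow> is_norm (\<lambda>v. c * \<eta> v)"
  by (rule is_normI)
    (simp_all add: is_norm_nonneg is_norm_eq_0_iff is_norm_scaleR is_norm_triangle mult.left_commute
      flip: distrib_left)

lemma injective_metric_space_all_norms: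
  "injective_metric_space (all_norms :: (real^'n \<Rightarrow> real) set) norm_dist"
  unfolding injective_metric_space_def
proof (intro conjI allI impI)
  show "Metric_space all_norms norm_dist" by (rule Metric_space_norm_dist)
  fix F :: "((real^'n \<Rightarrow> real) \<times> real) set"
  assume F: "F \<subseteq> all_norms \<times> {0..}" and
    le: "\<forall>(\<eta>, r)\<in>F. \<forall>(\<xi>, s)\<in>F. norm_dist \<eta> \<xi> \<le> r + s"
  have F_norm: "is_norm \<eta>" if "(\<eta>, r) \<in> F" for \<eta> r
    using F that by (auto simp: all_norms_iff)
  show "\<exists>\<zeta>\<in>all_norms. \<forall>(\<eta>, r)\<in>F. \<zeta> \<in> norms.mcball \<eta> r"
  proof (cases "F = {}")
    case True
    then show ?thesis using is_norm_norm by (auto simp: all_norms_iff)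
  next
    case False
    define N where "N = (\<lambda>(\<eta>, r) v. exp (- r) * \<eta> v) ` F"
    define \<zeta> where "\<zeta> v = (SUP \<eta>\<in>N. \<eta> v)" for v
    have N_ne: "N \<noteq> {}" using False by (simp add: N_def)
    have N_norm: "is_norm \<eta>" if "\<eta> \<in> N" for \<eta>
      using that by (auto simp: N_def intro: is_norm_scale F_norm)
    \<comment> \<open>Compatibility of two balls says exactly that the lower edge of one lies below
      the upper edge of the other. Hence the supremum of all lower edges is finite and stays below
      every upper edge.\<close>
    have N_le: "\<xi> v \<le> exp r * \<eta> v" if "(\<eta>, r) \<in> F" "\<xi> \<in> N" for \<eta> r \<xi> v
    proof -
      obtain \<xi>' s where \<xi>: "(\<xi>', s) \<in> F" "\<xi> = (\<lambda>v. exp (- s) * \<xi>' v)"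
        using \<open>\<xi> \<in> N\<close> by (auto simp: N_def)
      have "norm_dist \<xi>' \<eta> \<le> s + r" using le that(1) \<xi>(1) by blast
      then have "\<xi>' v \<le> exp (s + r) * \<eta> v"
        using norm_dist_le_iff[OF F_norm[OF \<xi>(1)] F_norm[OF that(1)]] by blast
      then show ?thesis by (simp add: \<xi>(2) exp_add exp_minus field_simps)
    qed
    have bdd: "bdd_above ((\<lambda>\<eta>. \<eta> v) ` N)" for v
    proof -
      obtain \<eta> r where "(\<eta>, r) \<in> F" using False by auto
      then show ?thesis using N_le[of \<eta> r _ v] by (auto intro!: bdd_aboveI)
    qed
    have \<zeta>: "is_norm \<zeta>"
      unfolding \<zeta>_def using N_ne N_norm bdd by (rule is_norm_SUP)
    have "norm_dist \<eta> \<zeta> \<le> r" if "(\<eta>, r) \<in> F" for \<eta> r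
    proof (subst norm_dist_le_iff[OF F_norm[OF that] \<zeta>], intro allI conjI)
      fix v
      have "(\<lambda>v. exp (- r) * \<eta> v) \<in> N" using that by (force simp: N_def)
      then have "exp (- r) * \<eta> v \<le> \<zeta> v"
        unfolding \<zeta>_def using cSUP_upper[OF _ bdd] by fastforce
      then show "\<eta> v \<le> exp r * \<zeta> v" by (simp add: exp_minus field_simps)
      show "\<zeta> v \<le> exp r * \<eta> v"
        unfolding \<zeta>_def using N_ne N_le[OF that] by (rule cSUP_least)
    qed
    moreover have "\<zeta> \<in> all_norms" using \<zeta> by (simp add: all_norms_iff)
    ultimately show ?thesis using F by (auto simp: norms.in_mcball)
  qed
qed

section \<open>Minimality\<close>

text \<open>The codomain is an arbitrary inner product space so that the test ellipsoids can be
  given by maps into \<open>real \<times> real^'n\<close>, whose components carry different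
  weights.\<close>

lemma norm_linear_in_euclidean_norms:
  fixes L :: "real^'n \<Rightarrow> 'b::real_inner"
  assumes "linear L" "\<And>w. L w = 0 \<Longrightarrow> w = 0"
  shows "(\<lambda>w. norm (L w)) \<in> euclidean_norms"
proof -
  have "is_inner_product (\<lambda>v w. L v \<bullet> L w)"
    unfolding is_inner_product_def bilinear_def
    using assms
    by (auto intro!: linearI simp: linear_add linear_scale inner_add inner_commute)
  then show ?thesis
    unfolding euclidean_norms_def norm_eq_sqrt_inner by blast
qed

lemma is_norm_norm_linear:
  fixes L :: "real^'n \<Rightarrow> 'b::real_normed_vector"
  assumes "linear L" "\<And>w. L w = 0 \<Longrightarrow> w = 0"
  shows "is_norm (\<lambda>w. norm (L w))"
  using assms by (intro is_normI) (auto simp: linear_add linear_scale norm_triangle_ineq)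

lemma euclidean_norms_scale:
  assumes "\<eta> \<in> euclidean_norms" "0 < s"
  shows "(\<lambda>v. s * \<eta> v) \<in> euclidean_norms"
proof -
  obtain b where b: "is_inner_product b" "\<eta> = (\<lambda>v. sqrt (b v v))"
    using assms(1) by (auto simp: euclidean_norms_def)
  have "is_inner_product (\<lambda>v w. s\<^sup>2 * b v w)"
    using b(1) assms(2) unfolding is_inner_product_def bilinear_def linear_iff
    by (simp add: algebra_simps)
  moreover have "(\<lambda>v. s * \<eta> v) = (\<lambda>v. sqrt (s\<^sup>2 * b v v))"
    using assms(2) by (simp add: b(2) real_sqrt_mult)
  ultimately show ?thesis
    unfolding euclidean_norms_def by blast
qed

text \<open>The ellipsoids degenerate to the segment between \<open>- v / \<eta> v\<close> and \<open>v / \<eta> v\<close>.\<close>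

lemma exists_euclidean_norm_above:
  fixes \<eta> :: "real^'n \<Rightarrow> real"
  assumes \<eta>: "is_norm \<eta>" and "v \<noteq> 0" "1 < c"
  obtains \<xi> where "\<xi> \<in> euclidean_norms" "is_norm \<xi>" "\<And>w. \<eta> w \<le> c * \<xi> w" "\<xi> v = \<eta> v"
proof -
  obtain C where C: "0 < C" "\<And>v. \<eta> v \<le> C * norm v"
    using is_norm_le_euclidean[OF \<eta>] by blast
  \<comment> \<open>Chosen so that the Cauchy-Schwarz factor \<open>sqrt (1 + t\<^sup>2)\<close>
    below is exactly \<open>c\<close>.\<close>
  define t where "t = sqrt (c\<^sup>2 - 1)"
  have t: "0 < t" "1 + t\<^sup>2 = c\<^sup>2"
    using \<open>1 < c\<close> by (simp_all add: t_def one_less_power)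
  define \<phi> where "\<phi> w = (w \<bullet> v) / (v \<bullet> v)" for w
  define u where "u w = w - \<phi> w *\<^sub>R v" for w
  \<comment> \<open>The first component is \<eta> along the line of \<open>v\<close>; the weight
    \<open>C / t\<close> on the orthogonal remainder gives \<open>\<eta> (u w) \<le> t * q\<close>
    below. At \<open>v\<close> the remainder vanishes, so the new norm agrees with \<eta>
    there.\<close>
  define L where "L w = (\<eta> v * \<phi> w, (C / t) *\<^sub>R u w)" for w
  have "linear L"
    by (rule linearI)
      (simp_all add: L_def u_def \<phi>_def inner_add_left add_divide_distrib algebra_simps)
  moreover have "w = 0" if "L w = 0" for w
    using that is_norm_pos[OF \<eta> \<open>v \<noteq> 0\<close>] C(1) t(1) by (auto simp: L_def u_def zero_prod_def)
  ultimately have L: "(\<lambda>w. norm (L w)) \<in> euclidean_norms" "is_norm (\<lambda>w. norm (L w))"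
    by (auto intro: norm_linear_in_euclidean_norms is_norm_norm_linear)
  have "\<eta> w \<le> c * norm (L w)" for w
  proof -
    define p where "p = \<eta> v * \<bar>\<phi> w\<bar>"
    define q where "q = C / t * norm (u w)"
    have norm_L: "norm (L w) = sqrt (p\<^sup>2 + q\<^sup>2)"
      by (simp add: L_def p_def q_def norm_Pair power_mult_distrib power_divide)
    have "\<eta> w = \<eta> (\<phi> w *\<^sub>R v + u w)" by (simp add: u_def)
    also have "\<dots> \<le> p + \<eta> (u w)"
      using is_norm_triangle[OF \<eta>, of "\<phi> w *\<^sub>R v" "u w"]
      by (simp add: p_def is_norm_scaleR[OF \<eta>] mult.commute)
    also have "\<dots> \<le> p + t * q"
      using C(2)[of "u w"] t(1) by (simp add: q_def)
    also have "\<dots> \<le> sqrt ((1 + t\<^sup>2) * (p\<^sup>2 + q\<^sup>2))"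
    proof (rule real_le_rsqrt)
      \<comment> \<open>Lagrange's identity, that is, Cauchy-Schwarz for the plane vectors (1, t)
        and (p, q).\<close>
      have "(1 + t\<^sup>2) * (p\<^sup>2 + q\<^sup>2) - (p + t * q)\<^sup>2 = (t * p - q)\<^sup>2" by algebra
      then show "(p + t * q)\<^sup>2 \<le> (1 + t\<^sup>2) * (p\<^sup>2 + q\<^sup>2)"
        using zero_le_power2[of "t * p - q"] by linarith
    qed
    also have "\<dots> = c * norm (L w)"
      using \<open>1 < c\<close> by (simp add: t(2) norm_L real_sqrt_mult)
    finally show ?thesis .
  qed
  moreover have "norm (L v) = \<eta> v"
    using \<open>v \<noteq> 0\<close> is_norm_nonneg[OF \<eta>] by (simp add: L_def u_def \<phi>_def norm_Pair)
  ultimately show thesis using L that by blast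
qed

text \<open>Finite-dimensional Hahn-Banach: a hyperplane separates \<open>v\<close> from the open
  \<eta>-ball whose boundary passes through \<open>v\<close>, and its normal vector is rescaled to
  have value \<open>\<eta> v\<close> at \<open>v\<close>.\<close>

lemma supporting_functional:
  fixes \<eta> :: "real^'n \<Rightarrow> real"
  assumes \<eta>: "is_norm \<eta>" and "v \<noteq> 0"
  obtains a where "\<And>w. \<bar>a \<bullet> w\<bar> \<le> \<eta> w" "a \<bullet> v = \<eta> v"
proof -
  let ?S = "{w. \<eta> w < \<eta> v}"
  have v: "0 < \<eta> v" using is_norm_pos[OF assms] .
  have "convex ?S"
  proof (rule convexI, clarify)
    fix x y :: "real^'n" and s t :: real
    assume st: "0 \<le> s" "0 \<le> t" "s + t = 1" and xy: "\<eta> x < \<eta> v" "\<eta> y < \<eta> v"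
    have "\<eta> (s *\<^sub>R x + t *\<^sub>R y) \<le> s * \<eta> x + t * \<eta> y"
      using is_norm_triangle[OF \<eta>, of "s *\<^sub>R x" "t *\<^sub>R y"] st by (simp add: is_norm_scaleR[OF \<eta>])
    also have "\<dots> < \<eta> v" using convex_bound_lt[OF xy st] .
    finally show "\<eta> (s *\<^sub>R x + t *\<^sub>R y) < \<eta> v" .
  qed
  moreover have "0 \<in> ?S" using v is_norm_eq_0_iff[OF \<eta>, of 0] by simp
  moreover have "?S \<inter> {v} = {}" by simp
  ultimately obtain b d where b: "b \<noteq> 0" "\<forall>w\<in>?S. b \<bullet> w \<le> d" "\<forall>w\<in>{v}. d \<le> b \<bullet> w"
    using separating_hyperplane_sets[of ?S "{v}"] by auto
  have le: "\<eta> v * (b \<bullet> w) \<le> \<eta> w * (b \<bullet> v)" for w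
  proof (cases "w = 0")
    case False
    then have w: "0 < \<eta> w" using is_norm_pos[OF \<eta>] by blast
    \<comment> \<open>The separated ball is open, so \<open>w\<close> is rescaled to \<eta>-length
      \<open>s * \<eta> v\<close> with \<open>s < 1\<close>; the bound for \<open>s = 1\<close>
      follows in the limit.\<close>
    have "s * (\<eta> v * (b \<bullet> w)) \<le> \<eta> w * (b \<bullet> v)" if "0 < s" "s < 1" for s
    proof -
      have "(s * \<eta> v / \<eta> w) *\<^sub>R w \<in> ?S"
        using that v w by (simp add: is_norm_scaleR[OF \<eta>])
      then have "b \<bullet> ((s * \<eta> v / \<eta> w) *\<^sub>R w) \<le> b \<bullet> v"
        using b by force
      then show ?thesis using w by (simp add: field_simps)
    qed
    then show ?thesis by (rule field_le_mult_one_interval)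
  qed (use is_norm_eq_0_iff[OF \<eta>, of 0] in simp)
  \<comment> \<open>Testing the inequality with the normal vector itself excludes
    \<open>b \<bullet> v \<le> 0\<close>, which the final rescaling divides by.\<close>
  have "0 < \<eta> v * (b \<bullet> b)" using v b(1) by simp
  also have "\<dots> \<le> \<eta> b * (b \<bullet> v)" by (rule le)
  finally have bv: "0 < b \<bullet> v"
    using is_norm_nonneg[OF \<eta>, of b] by (simp add: zero_less_mult_iff)
  show thesis
  proof
    let ?a = "(\<eta> v / (b \<bullet> v)) *\<^sub>R b"
    show "?a \<bullet> v = \<eta> v" using bv by simp
    show "\<bar>?a \<bullet> w\<bar> \<le> \<eta> w" for w
      using le[of w] le[of "- w"] bv
      by (simp add: abs_le_iff is_norm_minus[OF \<eta>] field_simps)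
  qed
qed

text \<open>The ellipsoids degenerate to the slab cut out by a supporting functional at \<open>v\<close>.\<close>

lemma exists_euclidean_norm_below:
  fixes \<eta> :: "real^'n \<Rightarrow> real"
  assumes \<eta>: "is_norm \<eta>" and "v \<noteq> 0" "1 < c"
  obtains \<xi> where "\<xi> \<in> euclidean_norms" "is_norm \<xi>" "\<And>w. \<xi> w \<le> c * \<eta> w" "\<eta> v \<le> \<xi> v"
proof -
  obtain a where a: "\<And>w. \<bar>a \<bullet> w\<bar> \<le> \<eta> w" "a \<bullet> v = \<eta> v"
    using supporting_functional[OF assms(1,2)] by blast
  obtain C where C: "1 \<le> C" "\<And>w. norm w \<le> C * \<eta> w"
    using is_norm_comparable[OF is_norm_norm \<eta>] by blast
  define t where "t = sqrt (c\<^sup>2 - 1)"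
  have t: "0 < t" "1 + t\<^sup>2 = c\<^sup>2"
    using \<open>1 < c\<close> by (simp_all add: t_def one_less_power)
  \<comment> \<open>The functional alone is degenerate. The Euclidean term makes the form definite,
    and its weight keeps it below \<open>t * \<eta> w\<close>, so that the two squares add up to at
    most \<open>(1 + t\<^sup>2) * (\<eta> w)\<^sup>2\<close>.\<close>
  define L where "L w = (a \<bullet> w, (t / C) *\<^sub>R w)" for w
  have "linear L"
    by (rule linearI) (simp_all add: L_def inner_add_right algebra_simps)
  moreover have "w = 0" if "L w = 0" for w
    using that C(1) t(1) by (auto simp: L_def zero_prod_def)
  ultimately have L: "(\<lambda>w. norm (L w)) \<in> euclidean_norms" "is_norm (\<lambda>w. norm (L w))"
    by (auto intro: norm_linear_in_euclidean_norms is_norm_norm_linear)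
  have "norm (L w) \<le> c * \<eta> w" for w
  proof -
    have "t / C * norm w \<le> t * \<eta> w"
      using C t(1) by (simp add: field_simps)
    then have "(t / C * norm w)\<^sup>2 \<le> (t * \<eta> w)\<^sup>2"
      using C(1) t(1) by (intro power_mono) auto
    moreover have "\<bar>a \<bullet> w\<bar>\<^sup>2 \<le> (\<eta> w)\<^sup>2"
      using a(1) by (intro power_mono) auto
    ultimately have "(a \<bullet> w)\<^sup>2 + (t / C * norm w)\<^sup>2 \<le> (1 + t\<^sup>2) * (\<eta> w)\<^sup>2"
      by (simp add: algebra_simps power_mult_distrib)
    then have "norm (L w) \<le> sqrt (c\<^sup>2 * (\<eta> w)\<^sup>2)"
      by (simp add: L_def norm_Pair t(2) power_mult_distrib power_divide)
    then show ?thesis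
      using \<open>1 < c\<close> is_norm_nonneg[OF \<eta>] by (simp add: real_sqrt_mult)
  qed
  moreover have "\<eta> v \<le> norm (L v)"
    using norm_fst_le[of "a \<bullet> v" "(t / C) *\<^sub>R v"] by (simp add: L_def a(2))
  ultimately show thesis using L that by blast
qed

lemma le_if_le_mult_gt_1:
  fixes a b :: real
  assumes "\<And>c. 1 < c \<Longrightarrow> a \<le> c * b" "0 \<le> b"
  shows "a \<le> b"
proof (rule tendsto_lowerbound)
  show "((\<lambda>c. c * b) \<longlongrightarrow> b) (at_right 1)"
    by (auto intro!: tendsto_eq_intros)
  show "\<forall>\<^sub>F c in at_right 1. a \<le> c * b"
    using assms(1) by (auto simp: eventually_at_filter)
qed simp

text \<open>
  Scaling \<open>\<xi>\<close> makes one of the two inequalities between a norm and \<open>\<xi>\<close> determine their distance;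
  in this way the distances to Euclidean norms see the norm itself and its dual norm.
\<close>

lemma norm_eqI_dist_euclidean:
  fixes \<eta> \<zeta> :: "real^'n \<Rightarrow> real"
  assumes \<eta>: "is_norm \<eta>" and \<zeta>: "is_norm \<zeta>"
    and le: "\<And>\<xi>. \<xi> \<in> euclidean_norms \<Longrightarrow> norm_dist \<zeta> \<xi> \<le> norm_dist \<eta> \<xi>"
  shows "\<zeta> = \<eta>"
proof (rule ext, rule antisym)
  fix v :: "real^'n"
  show "\<zeta> v \<le> \<eta> v"
  proof (cases "v = 0")
    case False
    show ?thesis
    proof (rule le_if_le_mult_gt_1)
      fix c :: real assume "1 < c"
      then obtain \<xi> where \<xi>: "\<xi> \<in> euclidean_norms" "is_norm \<xi>" "\<And>w. \<eta> w \<le> c * \<xi> w" "\<xi> v = \<eta> v"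
        using exists_euclidean_norm_above[OF \<eta> False] by blast
      obtain D where D: "1 \<le> D" "\<And>w. \<xi> w \<le> D * \<eta> w"
        using is_norm_comparable[OF \<xi>(2) \<eta>] by blast
      \<comment> \<open>Shrinking by \<open>D\<close> puts the ellipsoid norm below \<eta>, so only
        the inequality \<open>\<eta> \<le> c * D * \<xi>'\<close> limits the distance. For \<zeta>
        the same distance bound yields this inequality at \<open>v\<close>, where \<xi> and \<eta>
        agree.\<close>
      define \<xi>' where "\<xi>' w = inverse D * \<xi> w" for w
      have \<xi>': "\<xi>' \<in> euclidean_norms" "is_norm \<xi>'"
        using \<xi> D(1) unfolding \<xi>'_def by (auto intro: euclidean_norms_scale is_norm_scale)
      have exp: "exp (ln (c * D)) = c * D" using \<open>1 < c\<close> D(1) by simp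
      have "1 \<le> c * D" using mult_mono[of 1 c 1 D] \<open>1 < c\<close> D(1) by simp
      then have "1 * \<eta> w \<le> c * D * \<eta> w" for w
        using is_norm_nonneg[OF \<eta>] by (intro mult_right_mono) auto
      moreover have "\<xi>' w \<le> \<eta> w" "\<eta> w \<le> c * D * \<xi>' w" for w
        using D \<xi>(3)[of w] by (simp_all add: \<xi>'_def field_simps)
      ultimately have "norm_dist \<eta> \<xi>' \<le> ln (c * D)"
        unfolding norm_dist_le_iff[OF \<eta> \<xi>'(2)] exp by (metis mult_1 order_trans)
      then have "norm_dist \<zeta> \<xi>' \<le> ln (c * D)"
        using le[OF \<xi>'(1)] by simp
      then have "\<zeta> v \<le> c * D * \<xi>' v"
        unfolding norm_dist_le_iff[OF \<zeta> \<xi>'(2)] exp by blast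
      then show "\<zeta> v \<le> c * \<eta> v"
        using D(1) by (simp add: \<xi>'_def \<xi>(4) field_simps)
    qed (rule is_norm_nonneg[OF \<eta>])
  qed (use is_norm_eq_0_iff[OF \<eta>, of 0] is_norm_eq_0_iff[OF \<zeta>, of 0] in simp)
  show "\<eta> v \<le> \<zeta> v"
  proof (cases "v = 0")
    case False
    show ?thesis
    proof (rule le_if_le_mult_gt_1)
      fix c :: real assume "1 < c"
      then obtain \<xi> where \<xi>: "\<xi> \<in> euclidean_norms" "is_norm \<xi>" "\<And>w. \<xi> w \<le> c * \<eta> w" "\<eta> v \<le> \<xi> v"
        using exists_euclidean_norm_below[OF \<eta> False] by blast
      obtain D where D: "1 \<le> D" "\<And>w. \<eta> w \<le> D * \<xi> w"
        using is_norm_comparable[OF \<eta> \<xi>(2)] by blast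
      \<comment> \<open>The mirror image: enlarging by \<open>D\<close> puts the norm above \<eta>,
        and the upper bound on it now decides the distance.\<close>
      define \<xi>' where "\<xi>' w = D * \<xi> w" for w
      have \<xi>': "\<xi>' \<in> euclidean_norms" "is_norm \<xi>'"
        using \<xi> D(1) unfolding \<xi>'_def by (auto intro: euclidean_norms_scale is_norm_scale)
      have exp: "exp (ln (c * D)) = c * D" using \<open>1 < c\<close> D(1) by simp
      have "1 \<le> c * D" using mult_mono[of 1 c 1 D] \<open>1 < c\<close> D(1) by simp
      then have "1 * \<xi>' w \<le> c * D * \<xi>' w" for w
        using is_norm_nonneg[OF \<xi>'(2)] by (intro mult_right_mono) auto
      moreover have "\<eta> w \<le> \<xi>' w" "\<xi>' w \<le> c * D * \<eta> w" for w
        using D \<xi>(3)[of w] by (simp_all add: \<xi>'_def mult.assoc mult.left_commute[of c])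
      ultimately have "norm_dist \<eta> \<xi>' \<le> ln (c * D)"
        unfolding norm_dist_le_iff[OF \<eta> \<xi>'(2)] exp by (metis mult_1 order_trans)
      then have "norm_dist \<zeta> \<xi>' \<le> ln (c * D)"
        using le[OF \<xi>'(1)] by simp
      then have "\<xi>' v \<le> c * D * \<zeta> v"
        unfolding norm_dist_le_iff[OF \<zeta> \<xi>'(2)] exp by blast
      then have "\<xi> v \<le> c * \<zeta> v"
        using D(1) by (simp add: \<xi>'_def mult.assoc mult.left_commute[of c])
      then show "\<eta> v \<le> c * \<zeta> v"
        using \<xi>(4) by simp
    qed (rule is_norm_nonneg[OF \<zeta>])
  qed (use is_norm_eq_0_iff[OF \<eta>, of 0] is_norm_eq_0_iff[OF \<zeta>, of 0] in simp)
qed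

lemma injective_metric_space_norms_minimal:
  fixes Y :: "(real^'n \<Rightarrow> real) set"
  assumes "euclidean_norms \<subseteq> Y" "Y \<subseteq> all_norms" and Y: "injective_metric_space Y norm_dist"
  shows "Y = all_norms"
proof (rule antisym[OF assms(2)], rule subsetI)
  fix \<eta> :: "real^'n \<Rightarrow> real" assume \<eta>: "\<eta> \<in> all_norms"
  interpret Y: Metric_space Y norm_dist
    using Y by (simp add: injective_metric_space_def)
  \<comment> \<open>Each ball is just large enough to contain \<eta>. The triangle inequality
    through \<eta> makes the balls compatible, although \<eta> is not yet known to lie in
    \<open>Y\<close>.\<close>
  let ?F = "(\<lambda>\<xi>. (\<xi>, norm_dist \<eta> \<xi>)) ` euclidean_norms"
  have "?F \<subseteq> Y \<times> {0..}"
    using assms(1) norm_dist_nonneg by auto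
  moreover have "\<forall>(\<xi>, r)\<in>?F. \<forall>(\<xi>', s)\<in>?F. norm_dist \<xi> \<xi>' \<le> r + s"
    using norms.triangle''[OF _ \<eta>] assms(1,2) by (auto simp: subset_iff)
  ultimately obtain \<zeta> where \<zeta>: "\<zeta> \<in> Y" "\<forall>(\<xi>, r)\<in>?F. \<zeta> \<in> Y.mcball \<xi> r"
    using Y unfolding injective_metric_space_def by meson
  have "norm_dist \<zeta> \<xi> \<le> norm_dist \<eta> \<xi>" if "\<xi> \<in> euclidean_norms" for \<xi>
    using \<zeta>(2) that norm_dist_commute[of \<zeta> \<xi>] by auto
  then have "\<zeta> = \<eta>"
    using \<eta> \<zeta>(1) assms(2) by (intro norm_eqI_dist_euclidean) (auto simp: all_norms_iff)
  with \<zeta>(1) show "\<eta> \<in> Y" by simp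
qed

section \<open>Euclidean norms are cobounded\<close>

lemma matrix_inv_right_left:
  fixes A :: "real^'n^'n"
  assumes "invertible A"
  shows "A ** matrix_inv A = mat 1" "matrix_inv A ** A = mat 1"
  using someI_ex[OF assms[unfolded invertible_def]] by (simp_all add: matrix_inv_def)

lemma invertible_matrix_inv: "invertible (A :: real^'n^'n) \<Longrightarrow> invertible (matrix_inv A)"
  using matrix_inv_right_left unfolding invertible_def by blast

lemma matrix_inv_cancel:
  fixes A :: "real^'n^'n"
  assumes "invertible A"
  shows "A *v (matrix_inv A *v v) = v" "matrix_inv A *v (A *v v) = v"
  using matrix_inv_right_left[OF assms] by (simp_all add: matrix_vector_mul_assoc)

lemma is_norm_matrix:
  fixes A :: "real^'n^'n"
  assumes "is_norm \<eta>" "invertible A"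
  shows "is_norm (\<lambda>v. \<eta> (A *v v))"
proof (rule is_normI)
  show "v = 0" if "\<eta> (A *v v) = 0" for v
    using that is_norm_eq_0_iff[OF assms(1)] matrix_inv_cancel(2)[OF assms(2), of v] by simp
qed (use assms(1) in \<open>simp_all add: is_norm_nonneg is_norm_scaleR is_norm_triangle
      matrix_vector_mult_scaleR matrix_vector_right_distrib\<close>)

text \<open>An invertible matrix permutes the vectors, so an inequality quantified over all of them
  is unaffected by the substitution.\<close>

lemma norm_dist_matrix:
  fixes A :: "real^'n^'n"
  assumes norms: "is_norm \<eta>" "is_norm \<xi>" and A: "invertible A"
  shows "norm_dist (\<lambda>v. \<eta> (A *v v)) (\<lambda>v. \<xi> (A *v v)) = norm_dist \<eta> \<xi>"
proof -
  have all: "(\<forall>v. P (A *v v)) \<longleftrightarrow> (\<forall>v. P v)" for P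
    using matrix_inv_cancel(1)[OF A] by metis
  have "norm_dist (\<lambda>v. \<eta> (A *v v)) (\<lambda>v. \<xi> (A *v v)) \<le> r \<longleftrightarrow> norm_dist \<eta> \<xi> \<le> r" for r
    unfolding norm_dist_le_iff[OF norms]
      norm_dist_le_iff[OF norms[THEN is_norm_matrix[OF _ A]]]
    by (rule all)
  then show ?thesis by (meson order_antisym order_refl)
qed

section \<open>Auerbach bases\<close>

lemma bounded_matrices:
  fixes S :: "(real^'n^'m) set"
  assumes "\<And>A i j. A \<in> S \<Longrightarrow> \<bar>A $ i $ j\<bar> \<le> M"
  shows "bounded S"
proof -
  have "norm A \<le> (\<Sum>i\<in>(UNIV::'m set). \<Sum>j\<in>(UNIV::'n set). M)" if "A \<in> S" for A
  proof -
    have "norm A \<le> (\<Sum>i\<in>UNIV. norm (A $ i))"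
      by (simp add: norm_vec_def L2_set_le_sum)
    also have "\<dots> \<le> (\<Sum>i\<in>UNIV. \<Sum>j\<in>UNIV. \<bar>A $ i $ j\<bar>)"
      by (intro sum_mono norm_le_l1_cart)
    also have "\<dots> \<le> (\<Sum>i\<in>(UNIV::'m set). \<Sum>j\<in>(UNIV::'n set). M)"
      using assms[OF that] by (intro sum_mono)
    finally show ?thesis .
  qed
  then show ?thesis unfolding bounded_iff by blast
qed

lemma compact_columns_in_unit_ball:
  fixes \<eta> :: "real^'n \<Rightarrow> real"
  assumes \<eta>: "is_norm \<eta>"
  shows "compact {A :: real^'n^'n. \<forall>j. \<eta> (column j A) \<le> 1}" (is "compact ?K")
  unfolding compact_eq_bounded_closed
proof
  obtain D where D: "1 \<le> D" "\<And>v. norm v \<le> D * \<eta> v"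
    using is_norm_comparable[OF is_norm_norm \<eta>] by blast
  show "bounded ?K"
  proof (rule bounded_matrices)
    fix A i j assume "A \<in> ?K"
    have "\<bar>A $ i $ j\<bar> \<le> norm (column j A)"
      using component_le_norm_cart[of "column j A" i] by (simp add: column_def)
    also have "\<dots> \<le> D * \<eta> (column j A)" by (rule D)
    also have "\<dots> \<le> D" using \<open>A \<in> ?K\<close> D(1) by (simp add: mult_left_le)
    finally show "\<bar>A $ i $ j\<bar> \<le> D" .
  qed
  have "continuous_on UNIV (\<lambda>A. \<eta> (column j A))" for j
    using continuous_on_is_norm[OF \<eta>, of UNIV]
    by (rule continuous_on_compose2) (auto simp: column_def intro!: continuous_intros)
  then show "closed ?K"
    by (intro closed_Collect_all closed_Collect_le) auto
qed

text \<open>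
  Auerbach's argument: if \<open>\<bar>det A\<bar>\<close> is maximal among matrices with columns in the unit ball, then
  by Cramer's rule every point of the unit ball has coordinates at most 1 in the basis of columns.
\<close>

lemma exists_norm_dist_matrix_euclidean_le:
  fixes \<eta> :: "real^'n \<Rightarrow> real"
  assumes \<eta>: "is_norm \<eta>"
  obtains A :: "real^'n^'n"
  where "invertible A" "norm_dist (\<lambda>v. \<eta> (A *v v)) norm \<le> ln (real CARD('n))"
proof -
  let ?K = "{A :: real^'n^'n. \<forall>j. \<eta> (column j A) \<le> 1}"
  let ?n = "real CARD('n)"
  \<comment> \<open>The normalized standard basis: its determinant is nonzero, which forces the
    maximal determinant to be nonzero as well.\<close>
  define D :: "real^'n^'n" where "D = (\<chi> i j. if i = j then inverse (\<eta> (axis i 1)) else 0)"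
  have pos: "0 < \<eta> (axis i 1)" for i by (rule is_norm_pos[OF \<eta>]) simp
  have "column j D = inverse (\<eta> (axis j 1)) *\<^sub>R axis j 1" for j
    by (simp add: D_def column_def axis_def vec_eq_iff)
  then have "\<eta> (column j D) = 1" for j
    using pos[of j] by (simp add: is_norm_scaleR[OF \<eta>])
  then have "D \<in> ?K" by simp
  moreover have "continuous_on ?K (\<lambda>A. \<bar>det A\<bar>)"
    unfolding det_def by (intro continuous_intros)
  ultimately obtain A where A: "A \<in> ?K" "\<forall>B\<in>?K. \<bar>det B\<bar> \<le> \<bar>det A\<bar>"
    using continuous_attains_sup[OF compact_columns_in_unit_ball[OF \<eta>]] by blast
  have "det D = (\<Prod>i\<in>UNIV. inverse (\<eta> (axis i 1)))"
    by (subst det_diagonal) (simp_all add: D_def)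
  also have "\<dots> \<noteq> 0" using pos by (simp add: less_imp_neq[symmetric])
  finally have det: "0 < \<bar>det A\<bar>" using A(2) \<open>D \<in> ?K\<close> by fastforce
  then have inv: "invertible A" by (simp add: invertible_det_nz)
  have coord: "\<bar>c $ k\<bar> \<le> 1" if "\<eta> (A *v c) \<le> 1" for c k
  proof -
    \<comment> \<open>Column \<open>k\<close> is replaced by the point \<open>A *v c\<close> of the
      unit ball, which multiplies the determinant by \<open>c $ k\<close>; maximality bounds this
      factor by 1.\<close>
    let ?B = "(\<chi> i j. if j = k then (A *v c) $ i else A $ i $ j) :: real^'n^'n"
    have "column j ?B = (if j = k then A *v c else column j A)" for j
      by (simp add: column_def vec_eq_iff)
    then have "?B \<in> ?K" using that A(1) by simp
    then have "\<bar>det ?B\<bar> \<le> \<bar>det A\<bar>" using A(2) by blast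
    then show ?thesis using det by (simp add: cramer_lemma abs_mult)
  qed
  \<comment> \<open>Coordinates at most 1 are summed in the l1 norm. This crude bound costs the
    factor \<open>CARD('n)\<close>, as does the triangle inequality used for \<open>ge\<close>,
    whence the radius \<open>ln (real CARD('n))\<close>.\<close>
  have le1: "norm c \<le> ?n" if "\<eta> (A *v c) \<le> 1" for c
  proof -
    have "norm c \<le> (\<Sum>k\<in>UNIV. \<bar>c $ k\<bar>)" by (rule norm_le_l1_cart)
    also have "\<dots> \<le> (\<Sum>k\<in>(UNIV::'n set). 1)" by (intro sum_mono coord that)
    finally show ?thesis by simp
  qed
  note norm_A = is_norm_matrix[OF \<eta> inv]
  have le: "norm c \<le> ?n * \<eta> (A *v c)" for c
  proof (cases "c = 0")
    case False
    then have "0 < \<eta> (A *v c)" using is_norm_pos[OF norm_A] by blast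
    then show ?thesis
      using le1[of "inverse (\<eta> (A *v c)) *\<^sub>R c"]
      by (simp add: is_norm_scaleR[OF norm_A] field_simps)
  qed (use is_norm_eq_0_iff[OF \<eta>, of 0] in simp)
  have ge: "\<eta> (A *v c) \<le> ?n * norm c" for c
  proof -
    have "\<eta> (A *v c) \<le> (\<Sum>j\<in>UNIV. \<eta> ((c $ j) *\<^sub>R column j A))"
      unfolding matrix_mult_sum scalar_mult_eq_scaleR by (rule is_norm_sum_le[OF \<eta>]) simp
    also have "\<dots> \<le> (\<Sum>j\<in>(UNIV::'n set). norm c)"
    proof (rule sum_mono)
      fix j
      have "\<eta> ((c $ j) *\<^sub>R column j A) \<le> \<bar>c $ j\<bar>"
        using A(1) by (simp add: is_norm_scaleR[OF \<eta>] mult_left_le)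
      also have "\<dots> \<le> norm c" by (rule component_le_norm_cart)
      finally show "\<eta> ((c $ j) *\<^sub>R column j A) \<le> norm c" .
    qed
    finally show ?thesis by simp
  qed
  have "norm_dist (\<lambda>v. \<eta> (A *v v)) norm \<le> ln ?n"
    using le ge by (simp add: norm_dist_le_iff[OF norm_A is_norm_norm])
  with inv that show thesis by blast
qed

text \<open>The Auerbach radius does not depend on the norm, and precomposing with
  \<open>matrix_inv A\<close> carries the estimate back to \<eta>. The inclusion assumed here is
  supplied later by \<open>euclidean_norms_subset\<close>, a consequence of diagonalization.\<close>

lemma cobounded_euclidean_norms:
  assumes "euclidean_norms \<subseteq> (all_norms :: (real^'n \<Rightarrow> real) set)"
  shows "cobounded (euclidean_norms :: (real^'n \<Rightarrow> real) set) all_norms norm_dist"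
  unfolding cobounded_def
proof (intro conjI exI[of _ "ln (real CARD('n))"] ballI)
  fix \<eta> :: "real^'n \<Rightarrow> real" assume "\<eta> \<in> all_norms"
  then have \<eta>: "is_norm \<eta>" by (simp add: all_norms_iff)
  obtain A :: "real^'n^'n"
    where A: "invertible A" "norm_dist (\<lambda>v. \<eta> (A *v v)) norm \<le> ln (real CARD('n))"
    using exists_norm_dist_matrix_euclidean_le[OF \<eta>] by blast
  define \<xi> where "\<xi> v = norm (matrix_inv A *v v)" for v
  have "\<xi> \<in> euclidean_norms"
    unfolding \<xi>_def using matrix_inv_cancel(1)[OF A(1)]
    by (intro norm_linear_in_euclidean_norms matrix_vector_mul_linear) (metis matrix_vector_mult_0_right)
  moreover have "is_norm \<xi>"
    unfolding \<xi>_def using is_norm_norm invertible_matrix_inv[OF A(1)] by (rule is_norm_matrix)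
  then have "norm_dist \<eta> \<xi> \<le> ln (real CARD('n))"
    using A(2) norm_dist_matrix[OF \<eta> _ A(1), of \<xi>] by (simp add: \<xi>_def matrix_inv_cancel(2)[OF A(1)])
  ultimately show "\<exists>\<xi>\<in>euclidean_norms. norm_dist \<eta> \<xi> \<le> ln (real CARD('n))" by blast
qed (rule assms)

section \<open>Properness\<close>

text \<open>The factor 2 comes from \<open>1 / (1 - \<epsilon>) \<le> 1 + 2 * \<epsilon> \<le> exp
  (2 * \<epsilon>)\<close>, valid for \<epsilon> up to 1/2. This turns uniform estimates of
  differences of norms into estimates of their distance.\<close>

lemma norm_dist_le_if_relative_error:
  assumes norms: "is_norm \<eta>" "is_norm \<xi>" and "0 \<le> \<epsilon>" "\<epsilon> \<le> 1 / 2"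
    and le: "\<And>v. \<bar>\<eta> v - \<xi> v\<bar> \<le> \<epsilon> * \<xi> v"
  shows "norm_dist \<eta> \<xi> \<le> 2 * \<epsilon>"
  unfolding norm_dist_le_iff[OF norms]
proof (intro allI conjI)
  fix v
  have exp: "1 + 2 * \<epsilon> \<le> exp (2 * \<epsilon>)" by (rule exp_ge_add_one_self)
  have "\<eta> v \<le> (1 + 2 * \<epsilon>) * \<xi> v"
    using le[of v] mult_nonneg_nonneg[OF \<open>0 \<le> \<epsilon>\<close> is_norm_nonneg[OF norms(2), of v]]
    by (simp add: algebra_simps abs_le_iff)
  also have "\<dots> \<le> exp (2 * \<epsilon>) * \<xi> v"
    using exp is_norm_nonneg[OF norms(2)] by (rule mult_right_mono)
  finally show "\<eta> v \<le> exp (2 * \<epsilon>) * \<xi> v" .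
  have "1 \<le> (1 + 2 * \<epsilon>) * (1 - \<epsilon>)"
    using mult_nonneg_nonneg[of \<epsilon> "1 - 2 * \<epsilon>"] assms(3,4) by (simp add: algebra_simps)
  then have "1 * \<xi> v \<le> (1 + 2 * \<epsilon>) * (1 - \<epsilon>) * \<xi> v"
    using is_norm_nonneg[OF norms(2)] by (rule mult_right_mono)
  also have "\<dots> = (1 + 2 * \<epsilon>) * ((1 - \<epsilon>) * \<xi> v)" by simp
  also have "\<dots> \<le> (1 + 2 * \<epsilon>) * \<eta> v"
    using le[of v] \<open>0 \<le> \<epsilon>\<close> by (intro mult_left_mono) (auto simp: algebra_simps abs_le_iff)
  also have "\<dots> \<le> exp (2 * \<epsilon>) * \<eta> v"
    using exp is_norm_nonneg[OF norms(1)] by (rule mult_right_mono)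
  finally show "\<xi> v \<le> exp (2 * \<epsilon>) * \<eta> v" by simp
qed

text \<open>Norms are determined by their values on the Euclidean unit sphere, where the members of
  a ball are uniformly bounded and share a Lipschitz constant. Belonging to the ball also provides
  the lower bound that keeps the limit from degenerating.\<close>

lemma compactin_mcball_norms:
  fixes \<eta>\<^sub>0 :: "real^'n \<Rightarrow> real"
  assumes "is_norm \<eta>\<^sub>0"
  shows "compactin norms.mtopology (norms.mcball \<eta>\<^sub>0 r)"
  unfolding norms.compactin_sequentially
proof (intro conjI allI impI)
  show "norms.mcball \<eta>\<^sub>0 r \<subseteq> all_norms" by (rule norms.mcball_subset_mspace)
  fix \<sigma> :: "nat \<Rightarrow> real^'n \<Rightarrow> real"
  assume "range \<sigma> \<subseteq> norms.mcball \<eta>\<^sub>0 r"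
  then have \<sigma>: "is_norm (\<sigma> n)" "norm_dist \<eta>\<^sub>0 (\<sigma> n) \<le> r" for n
    by (auto simp: all_norms_iff image_subset_iff)
  have \<sigma>_le: "\<eta>\<^sub>0 v \<le> exp r * \<sigma> n v" "\<sigma> n v \<le> exp r * \<eta>\<^sub>0 v" for n v
    using \<sigma>(2)[of n] by (auto simp: norm_dist_le_iff[OF assms \<sigma>(1)])
  obtain C where C: "0 < C" "\<And>v. \<eta>\<^sub>0 v \<le> C * norm v"
    using is_norm_le_euclidean[OF assms] by blast
  define M where "M = exp r * C"
  have M: "0 < M" "\<sigma> n v \<le> M * norm v" for n v
    using C(1) order_trans[OF \<sigma>_le(2) mult_left_mono[OF C(2)[of v], of "exp r"]]
    by (simp_all add: M_def mult.assoc)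
  obtain g k where "strict_mono (k :: nat \<Rightarrow> nat)"
    and lim: "\<And>e. 0 < e \<Longrightarrow> \<exists>N. \<forall>n v. N \<le> n \<and> v \<in> sphere 0 1 \<longrightarrow> norm (\<sigma> (k n) v - g v) < e"
  proof (rule Arzela_Ascoli[of "sphere 0 1 :: (real^'n) set" \<sigma> M])
    show "norm (\<sigma> n v) \<le> M" if "v \<in> sphere 0 1" for n v
      using M(2)[of n v] is_norm_nonneg[OF \<sigma>(1)] that by simp
    show "\<exists>d>0. \<forall>n w. w \<in> sphere 0 1 \<and> norm (v - w) < d \<longrightarrow> norm (\<sigma> n v - \<sigma> n w) < e"
      if "0 < e" for v e
    proof (intro exI[of _ "e / M"] conjI allI impI)
      show "0 < e / M" using that M(1) by simp
      fix n w assume "w \<in> sphere 0 1 \<and> norm (v - w) < e / M"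
      then have "M * norm (v - w) < e" using M(1) by (simp add: field_simps)
      then show "norm (\<sigma> n v - \<sigma> n w) < e"
        using is_norm_diff_le[OF \<sigma>(1), of n v w] M(2)[of n "v - w"] by simp
    qed
  qed (blast | simp)+
  \<comment> \<open>The homogeneous extension of the limit on the sphere; the factor
    \<open>norm v\<close> gives \<open>l 0 = 0\<close> whatever \<open>g\<close> is at 0.\<close>
  define l where "l v = norm v * g (inverse (norm v) *\<^sub>R v)" for v
  have \<sigma>_l: "\<exists>N. \<forall>n\<ge>N. \<forall>v. \<bar>\<sigma> (k n) v - l v\<bar> \<le> e * norm v" if e: "0 < e" for e
  proof -
    obtain N where N: "\<And>n v. N \<le> n \<Longrightarrow> v \<in> sphere 0 1 \<Longrightarrow> \<bar>\<sigma> (k n) v - g v\<bar> < e"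
      using lim[OF e] by auto
    have "\<bar>\<sigma> (k n) v - l v\<bar> \<le> e * norm v" if "N \<le> n" for n v
    proof (cases "v = 0")
      case False
      let ?u = "inverse (norm v) *\<^sub>R v"
      have "\<sigma> (k n) v = norm v * \<sigma> (k n) ?u"
        using False by (simp add: is_norm_scaleR[OF \<sigma>(1)])
      then have "\<bar>\<sigma> (k n) v - l v\<bar> = norm v * \<bar>\<sigma> (k n) ?u - g ?u\<bar>"
        by (simp add: l_def abs_mult flip: right_diff_distrib)
      also have "\<dots> \<le> norm v * e"
        using N[OF that, of ?u] False by (intro mult_left_mono) auto
      finally show ?thesis by (simp add: mult.commute)
    qed (use is_norm_eq_0_iff[OF \<sigma>(1), of "k n" 0] in \<open>simp add: l_def\<close>)
    then show ?thesis by blast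
  qed
  have lim_l: "(\<lambda>n. \<sigma> (k n) v) \<longlonglongrightarrow> l v" for v
  proof (rule LIMSEQ_I)
    fix e :: real assume e: "0 < e"
    then obtain N where "\<forall>n\<ge>N. \<forall>w. \<bar>\<sigma> (k n) w - l w\<bar> \<le> e / (1 + norm v) * norm w"
      using \<sigma>_l[of "e / (1 + norm v)"] by (auto simp: add_pos_nonneg)
    moreover have "e / (1 + norm v) * norm v < e"
      using e norm_ge_zero[of v] by (simp add: divide_simps add_pos_nonneg algebra_simps)
    ultimately show "\<exists>N. \<forall>n\<ge>N. norm (\<sigma> (k n) v - l v) < e"
      by (auto intro: le_less_trans)
  qed
  have l_le: "\<eta>\<^sub>0 v \<le> exp r * l v" "l v \<le> exp r * \<eta>\<^sub>0 v" for v
    using \<sigma>_le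
    by (auto intro: LIMSEQ_le_const[OF tendsto_mult_left[OF lim_l]] LIMSEQ_le_const2[OF lim_l])
  have l: "is_norm l"
  proof (rule is_normI)
    fix v w :: "real^'n" and a :: real
    show "0 \<le> l v"
      using is_norm_nonneg[OF \<sigma>(1)] by (intro LIMSEQ_le_const[OF lim_l]) auto
    show "v = 0" if "l v = 0"
      using that l_le(1)[of v] is_norm_pos[OF assms, of v] by fastforce
    show "l (a *\<^sub>R v) = \<bar>a\<bar> * l v"
      using lim_l[of "a *\<^sub>R v"] tendsto_mult_left[OF lim_l[of v], of "\<bar>a\<bar>"]
      by (simp add: is_norm_scaleR[OF \<sigma>(1)] LIMSEQ_unique)
    show "l (v + w) \<le> l v + l w"
      using is_norm_triangle[OF \<sigma>(1)]
      by (intro LIMSEQ_le[OF lim_l tendsto_add[OF lim_l lim_l]]) auto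
  qed
  \<comment> \<open>Turns an error relative to the Euclidean norm into one relative to the limit, as
    the distance estimate requires.\<close>
  obtain D where D: "1 \<le> D" "\<And>v. norm v \<le> D * l v"
    using is_norm_comparable[OF is_norm_norm l] by blast
  have "limitin norms.mtopology (\<sigma> \<circ> k) l sequentially"
    unfolding norms.limit_metric_sequentially
  proof (intro conjI allI impI)
    show "l \<in> all_norms" using l by (simp add: all_norms_iff)
    fix \<epsilon> :: real assume "0 < \<epsilon>"
    define \<delta> where "\<delta> = min (\<epsilon> / 4) (1 / 2)"
    have \<delta>: "0 < \<delta>" "\<delta> \<le> 1 / 2" "2 * \<delta> < \<epsilon>" using \<open>0 < \<epsilon>\<close> by (auto simp: \<delta>_def)
    obtain N where N: "\<And>n v. N \<le> n \<Longrightarrow> \<bar>\<sigma> (k n) v - l v\<bar> \<le> \<delta> / D * norm v"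
      using \<sigma>_l[of "\<delta> / D"] \<delta>(1) D(1) by auto
    have "norm_dist (\<sigma> (k n)) l \<le> 2 * \<delta>" if "N \<le> n" for n
    proof (rule norm_dist_le_if_relative_error[OF \<sigma>(1) l])
      fix v
      have "\<bar>\<sigma> (k n) v - l v\<bar> \<le> \<delta> / D * norm v" using N[OF that] .
      also have "\<dots> \<le> \<delta> / D * (D * l v)"
        using \<delta>(1) D by (intro mult_left_mono) auto
      finally show "\<bar>\<sigma> (k n) v - l v\<bar> \<le> \<delta> * l v" using D(1) by simp
    qed (use \<delta> in auto)
    then show "\<exists>N. \<forall>n\<ge>N. (\<sigma> \<circ> k) n \<in> all_norms \<and> norm_dist ((\<sigma> \<circ> k) n) l < \<epsilon>"
      using \<sigma>(1) \<delta>(3) by (intro exI[of _ N]) (force simp: all_norms_iff)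
  qed
  moreover have "l \<in> norms.mcball \<eta>\<^sub>0 r"
    using assms l l_le by (simp add: all_norms_iff norm_dist_le_iff)
  ultimately show "\<exists>l k. l \<in> norms.mcball \<eta>\<^sub>0 r \<and> strict_mono k \<and>
      limitin norms.mtopology (\<sigma> \<circ> k) l sequentially"
    using \<open>strict_mono k\<close> by blast
qed

lemma proper_metric_space_all_norms:
  "proper_metric_space (all_norms :: (real^'n \<Rightarrow> real) set) norm_dist"
  unfolding proper_metric_space_def
  using Metric_space_norm_dist compactin_mcball_norms by (auto simp: all_norms_iff)

section \<open>The action of the general linear group\<close>

lemma GL_simps:
  "carrier GL = {A :: real^'n^'n. invertible A}"
  "x \<otimes>\<^bsub>GL\<^esub> y = x ** (y :: real^'n^'n)"
  "\<one>\<^bsub>GL\<^esub> = (mat 1 :: real^'n^'n)"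
  by (simp_all add: GL_def)

lemma matrix_inv_mult:
  fixes A B :: "real^'n^'n"
  assumes "invertible A" "invertible B"
  shows "invertible (A ** B)" "matrix_inv (A ** B) = matrix_inv B ** matrix_inv A"
proof -
  have 1: "A ** B ** (matrix_inv B ** matrix_inv A) = mat 1"
    using matrix_inv_right_left[OF assms(1)] matrix_inv_right_left[OF assms(2)]
    by (metis matrix_mul_assoc matrix_mul_rid)
  have 2: "matrix_inv B ** matrix_inv A ** (A ** B) = mat 1"
    using matrix_inv_right_left[OF assms(1)] matrix_inv_right_left[OF assms(2)]
    by (metis matrix_mul_assoc matrix_mul_rid)
  show inv: "invertible (A ** B)"
    unfolding invertible_def using 1 2 by blast
  show "matrix_inv (A ** B) = matrix_inv B ** matrix_inv A"
    using matrix_inv_right_left(2)[OF inv] 1 by (metis matrix_mul_assoc matrix_mul_lid matrix_mul_rid)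
qed

lemma matrix_inv_matrix_inv: "invertible (A :: real^'n^'n) \<Longrightarrow> matrix_inv (matrix_inv A) = A"
  using matrix_inv_right_left(2) matrix_inv_right_left(2)[OF invertible_matrix_inv]
  by (metis matrix_mul_assoc matrix_mul_lid matrix_mul_rid)

lemma group_GL: "group (GL :: (real^'n^'n) monoid)"
proof (rule groupI)
  show "\<exists>B\<in>carrier GL. B \<otimes>\<^bsub>GL\<^esub> A = \<one>\<^bsub>GL\<^esub>" if "A \<in> carrier GL" for A :: "real^'n^'n"
    using that invertible_matrix_inv matrix_inv_right_left(2) by (auto simp: GL_simps)
qed (auto simp: GL_simps matrix_inv_mult(1) matrix_mul_assoc invertible_def[of "mat 1"])

lemma GL_act_apply: "is_norm \<eta> \<Longrightarrow> GL_act A \<eta> = (\<lambda>v. \<eta> (matrix_inv A *v v))"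
  by (simp add: GL_act_def all_norms_iff)

lemma is_norm_GL_act: "invertible A \<Longrightarrow> is_norm \<eta> \<Longrightarrow> is_norm (GL_act A \<eta>)"
  by (simp add: GL_act_apply is_norm_matrix invertible_matrix_inv)

lemma GL_act_matrix_vector:
  "invertible A \<Longrightarrow> is_norm \<eta> \<Longrightarrow> GL_act A \<eta> (A *v v) = \<eta> v"
  by (simp add: GL_act_apply matrix_inv_cancel)

lemma norm_dist_GL_act:
  "invertible A \<Longrightarrow> is_norm \<eta> \<Longrightarrow> is_norm \<xi> \<Longrightarrow> norm_dist (GL_act A \<eta>) (GL_act A \<xi>) = norm_dist \<eta> \<xi>"
  by (simp add: GL_act_apply norm_dist_matrix invertible_matrix_inv)

lemma GL_act_mult:
  "invertible A \<Longrightarrow> invertible B \<Longrightarrow> is_norm \<eta> \<Longrightarrow> GL_act (A ** B) \<eta> = GL_act A (GL_act B \<eta>)"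
  by (simp add: GL_act_apply is_norm_matrix invertible_matrix_inv matrix_inv_mult(2)
      matrix_vector_mul_assoc)

lemma GL_act_inverse:
  assumes "invertible A" "is_norm \<eta>"
  shows "GL_act A (GL_act (matrix_inv A) \<eta>) = \<eta>" "GL_act (matrix_inv A) (GL_act A \<eta>) = \<eta>"
  using assms
  by (simp_all add: GL_act_apply is_norm_matrix invertible_matrix_inv matrix_inv_matrix_inv
      matrix_inv_cancel)

lemma isometric_action_GL:
  "isometric_action GL (all_norms :: (real^'n \<Rightarrow> real) set) norm_dist GL_act"
proof -
  have bij: "GL_act A \<in> Bij all_norms" if "invertible A" for A :: "real^'n^'n"
  proof -
    have "bij_betw (GL_act A) all_norms all_norms"
      by (rule bij_betw_byWitness[of _ "GL_act (matrix_inv A)"])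
        (auto simp: all_norms_iff GL_act_inverse is_norm_GL_act invertible_matrix_inv that)
    then show ?thesis by (simp add: Bij_def GL_act_def)
  qed
  have "GL_act (A ** B) = compose all_norms (GL_act A) (GL_act B)"
    if "invertible A" "invertible B" for A B :: "real^'n^'n"
  \<comment> \<open>\<open>BijGroup\<close> consists of extensional maps, so the two sides also have
    to agree, as \<open>undefined\<close>, outside \<open>all_norms\<close>.\<close>
  proof (rule extensionalityI)
    show "GL_act (A ** B) \<in> extensional all_norms" by (simp add: GL_act_def)
    show "GL_act (A ** B) \<eta> = compose all_norms (GL_act A) (GL_act B) \<eta>" if "\<eta> \<in> all_norms" for \<eta>
      using that \<open>invertible A\<close> \<open>invertible B\<close> by (simp add: compose_eq GL_act_mult all_norms_iff)
  qed (rule compose_extensional)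
  then have "GL_act \<in> hom GL (BijGroup (all_norms :: (real^'n \<Rightarrow> real) set))"
    by (auto intro!: homI simp: GL_simps bij BijGroup_def)
  then have "group_hom GL (BijGroup (all_norms :: (real^'n \<Rightarrow> real) set)) GL_act"
    by (simp add: group_hom_def group_hom_axioms_def group_GL group_BijGroup)
  then show ?thesis
    unfolding isometric_action_def group_action_def
    by (simp add: GL_simps all_norms_iff norm_dist_GL_act)
qed

text \<open>By Auerbach's argument every orbit meets the closed ball of radius
  \<open>ln (real CARD('n))\<close> around the Euclidean norm, and closed balls are compact.\<close>

lemma cocompact_action_GL:
  "cocompact_action GL (norms.mtopology :: (real^'n \<Rightarrow> real) topology) GL_act"
  unfolding cocompact_action_def
proof (intro exI conjI)
  let ?K = "norms.mcball (norm :: real^'n \<Rightarrow> real) (ln (real CARD('n)))"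
  show "compactin norms.mtopology ?K"
    by (rule compactin_mcball_norms[OF is_norm_norm])
  show "(\<Union>A\<in>carrier GL. GL_act A ` ?K) = topspace norms.mtopology"
  proof (intro equalityI subsetI)
    fix \<eta> :: "real^'n \<Rightarrow> real" assume "\<eta> \<in> topspace norms.mtopology"
    then have \<eta>: "is_norm \<eta>" by (simp add: all_norms_iff)
    obtain A :: "real^'n^'n"
      where A: "invertible A" "norm_dist (\<lambda>v. \<eta> (A *v v)) norm \<le> ln (real CARD('n))"
      using exists_norm_dist_matrix_euclidean_le[OF \<eta>] by blast
    let ?\<xi> = "\<lambda>v. \<eta> (A *v v)"
    have "?\<xi> \<in> ?K"
      using A norm_dist_commute[of norm ?\<xi>]
      by (simp add: all_norms_iff is_norm_norm is_norm_matrix[OF \<eta>])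
    moreover have "GL_act A ?\<xi> = \<eta>"
      using A(1) by (simp add: GL_act_apply is_norm_matrix[OF \<eta>] matrix_inv_cancel(1))
    ultimately show "\<eta> \<in> (\<Union>A\<in>carrier GL. GL_act A ` ?K)"
      using A(1) by (force simp: GL_simps)
  qed (auto simp: all_norms_iff GL_simps is_norm_GL_act)
qed

section \<open>Continuity and properness of the action\<close>

lemma norm_matrix_vector_mult_le:
  fixes A :: "real^'n^'m"
  shows "norm (A *v v) \<le> real CARD('m) * norm A * norm v"
proof -
  have "norm (A *v v) \<le> (\<Sum>i\<in>UNIV. \<bar>(A *v v) $ i\<bar>)" by (rule norm_le_l1_cart)
  also have "\<dots> \<le> (\<Sum>i\<in>(UNIV::'m set). norm A * norm v)"
  proof (rule sum_mono)
    fix i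
    have "\<bar>(A *v v) $ i\<bar> \<le> norm (A $ i) * norm v"
      unfolding matrix_vector_mul_component by (rule Cauchy_Schwarz_ineq2)
    also have "\<dots> \<le> norm A * norm v"
      by (intro mult_right_mono Finite_Cartesian_Product.norm_nth_le) simp
    finally show "\<bar>(A *v v) $ i\<bar> \<le> norm A * norm v" .
  qed
  finally show ?thesis by (simp add: mult.assoc)
qed

text \<open>Translating by \<open>B\<^sup>-\<^sup>1\<close> compares \<open>\<zeta> \<circ> B\<close> with \<open>\<zeta> \<circ> A\<close> for \<open>\<zeta> = GL_act A \<eta>\<close> fixed.\<close>

lemma continuous_GL_act_left:
  fixes A :: "real^'n^'n"
  assumes A: "invertible A" and \<eta>: "is_norm \<eta>" and "0 < \<epsilon>"
  obtains \<delta> where "0 < \<delta>"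
    "\<And>B. invertible B \<Longrightarrow> dist A B < \<delta> \<Longrightarrow> norm_dist (GL_act A \<eta>) (GL_act B \<eta>) < \<epsilon>"
proof -
  let ?\<zeta> = "GL_act A \<eta>"
  have \<zeta>: "is_norm ?\<zeta>" by (rule is_norm_GL_act[OF A \<eta>])
  obtain C where C: "0 < C" "\<And>v. ?\<zeta> v \<le> C * norm v"
    using is_norm_le_euclidean[OF \<zeta>] by blast
  obtain D where D: "1 \<le> D" "\<And>v. norm v \<le> D * \<eta> v"
    using is_norm_comparable[OF is_norm_norm \<eta>] by blast
  \<comment> \<open>Bounds the variation of \<open>\<zeta> (B *v v)\<close> in \<open>B\<close>
    relative to \<open>\<eta> v\<close>: \<open>C\<close> compares \<zeta> with the Euclidean norm,
    \<open>CARD('n)\<close> comes from the matrix bound, and \<open>D\<close> compares the Euclidean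
    norm with \<eta>.\<close>
  define K where "K = C * real CARD('n) * D"
  have K: "0 < K" using C(1) D(1) by (simp add: K_def)
  define t where "t = min (\<epsilon> / 4) (1 / 2)"
  have t: "0 < t" "t \<le> 1 / 2" "2 * t < \<epsilon>" using \<open>0 < \<epsilon>\<close> by (auto simp: t_def)
  show thesis
  proof
    show "0 < t / K" using t(1) K by simp
    fix B :: "real^'n^'n" assume B: "invertible B" and "dist A B < t / K"
    then have le_t: "K * norm (B - A) \<le> t"
      using K by (simp add: dist_norm norm_minus_commute field_simps)
    have \<zeta>B: "is_norm (\<lambda>v. ?\<zeta> (B *v v))" by (rule is_norm_matrix[OF \<zeta> B])
    have "norm_dist ?\<zeta> (GL_act B \<eta>) = norm_dist (\<lambda>v. ?\<zeta> (B *v v)) \<eta>"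
      using norm_dist_matrix[OF \<zeta> is_norm_GL_act[OF B \<eta>] B] by (simp add: GL_act_matrix_vector[OF B \<eta>])
    also have "\<dots> \<le> 2 * t"
    proof (rule norm_dist_le_if_relative_error[OF \<zeta>B \<eta>])
      fix v
      have "\<bar>?\<zeta> (B *v v) - \<eta> v\<bar> = \<bar>?\<zeta> (B *v v) - ?\<zeta> (A *v v)\<bar>"
        by (simp add: GL_act_matrix_vector[OF A \<eta>])
      also have "\<dots> \<le> ?\<zeta> ((B - A) *v v)"
        using is_norm_diff_le[OF \<zeta>] by (simp add: matrix_vector_mult_diff_rdistrib)
      also have "\<dots> \<le> C * norm ((B - A) *v v)" by (rule C)
      also have "\<dots> \<le> C * (real CARD('n) * norm (B - A) * norm v)"
        using C(1) by (intro mult_left_mono norm_matrix_vector_mult_le) auto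
      also have "\<dots> \<le> C * (real CARD('n) * norm (B - A) * (D * \<eta> v))"
        using C(1) D(2) by (intro mult_left_mono) auto
      also have "\<dots> = K * norm (B - A) * \<eta> v" by (simp add: K_def)
      also have "\<dots> \<le> t * \<eta> v"
        using le_t is_norm_nonneg[OF \<eta>] by (rule mult_right_mono)
      finally show "\<bar>?\<zeta> (B *v v) - \<eta> v\<bar> \<le> t * \<eta> v" .
    qed (use t in auto)
    finally show "norm_dist ?\<zeta> (GL_act B \<eta>) < \<epsilon>" using t(3) by simp
  qed
qed

text \<open>Since each \<open>B\<close> acts isometrically, moving \<eta> to \<xi> changes the image
  under \<open>B\<close> by exactly \<open>norm_dist \<eta> \<xi>\<close>. Joint continuity thus
  reduces to continuity in the matrix for one fixed norm.\<close>

lemma continuous_map_GL_act: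
  "continuous_map (prod_topology GL_topology norms.mtopology)
     (norms.mtopology :: (real^'n \<Rightarrow> real) topology) (\<lambda>(A, \<eta>). GL_act A \<eta>)"
  unfolding norms.continuous_map_to_metric
proof (intro ballI allI impI)
  fix p :: "(real^'n^'n) \<times> (real^'n \<Rightarrow> real)" and \<epsilon> :: real
  assume "p \<in> topspace (prod_topology GL_topology norms.mtopology)" and \<epsilon>: "0 < \<epsilon>"
  then obtain A \<eta> where p: "p = (A, \<eta>)" and A: "invertible A" and \<eta>: "is_norm \<eta>"
    by (cases p) (auto simp: GL_topology_def GL_simps all_norms_iff)
  obtain \<delta> where \<delta>: "0 < \<delta>"
    "\<And>B. invertible B \<Longrightarrow> dist A B < \<delta> \<Longrightarrow> norm_dist (GL_act A \<eta>) (GL_act B \<eta>) < \<epsilon> / 2"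
    using continuous_GL_act_left[OF A \<eta>, of "\<epsilon> / 2"] \<epsilon> by auto
  let ?U = "(carrier GL \<inter> ball A \<delta>) \<times> norms.mball \<eta> (\<epsilon> / 2)"
  show "\<exists>U. openin (prod_topology GL_topology norms.mtopology) U \<and> p \<in> U \<and>
    (\<forall>q\<in>U. (case q of (A, \<eta>) \<Rightarrow> GL_act A \<eta>) \<in> norms.mball (case p of (A, \<eta>) \<Rightarrow> GL_act A \<eta>) \<epsilon>)"
  proof (intro exI conjI ballI)
    show "openin (prod_topology GL_topology norms.mtopology) ?U"
      unfolding openin_prod_Times_iff GL_topology_def by (simp add: openin_open_Int)
    show "p \<in> ?U" using A \<eta> \<delta>(1) \<epsilon> by (simp add: p GL_simps all_norms_iff)
    fix q assume "q \<in> ?U"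
    then obtain B \<xi> where q: "q = (B, \<xi>)" and B: "invertible B" "dist A B < \<delta>"
      and \<xi>: "is_norm \<xi>" "norm_dist \<eta> \<xi> < \<epsilon> / 2"
      by (cases q) (auto simp: GL_simps all_norms_iff)
    have "norm_dist (GL_act A \<eta>) (GL_act B \<xi>)
        \<le> norm_dist (GL_act A \<eta>) (GL_act B \<eta>) + norm_dist (GL_act B \<eta>) (GL_act B \<xi>)"
      using A B(1) \<eta> \<xi>(1) by (intro norms.triangle) (auto simp: all_norms_iff is_norm_GL_act)
    also have "\<dots> < \<epsilon>"
      using \<delta>(2)[OF B] \<xi>(2) by (simp add: norm_dist_GL_act B(1) \<eta> \<xi>(1))
    finally show "(case q of (A, \<eta>) \<Rightarrow> GL_act A \<eta>) \<in> norms.mball (case p of (A, \<eta>) \<Rightarrow> GL_act A \<eta>) \<epsilon>"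
      using A B(1) \<eta> \<xi>(1) by (simp add: p q all_norms_iff is_norm_GL_act)
  qed
qed

text \<open>The invertible matrices are not closed among all matrices, but the lower bound on
  \<open>norm (A *v v)\<close> passes to limits and excludes a kernel. So the set is compact in the
  space of all matrices and lies in the group.\<close>

lemma compactin_GL_quasi_isometries:
  "compactin GL_topology {A :: real^'n^'n. \<forall>v. norm (A *v v) \<le> M * norm v \<and> norm v \<le> M * norm (A *v v)}"
    (is "compactin _ ?C")
proof -
  have "bounded ?C"
  proof (rule bounded_matrices)
    fix A i j assume "A \<in> ?C"
    have "\<bar>A $ i $ j\<bar> \<le> norm (A *v axis j 1)"
      using component_le_norm_cart[of "column j A" i] by (simp add: matrix_vector_mult_basis) (simp add: column_def)
    also have "\<dots> \<le> M * norm (axis j (1::real) :: real^'n)" using \<open>A \<in> ?C\<close> by blast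
    finally show "\<bar>A $ i $ j\<bar> \<le> M" by simp
  qed
  moreover have "continuous_on UNIV (\<lambda>A :: real^'n^'n. A *v v)" for v
    unfolding matrix_vector_mult_def by (intro continuous_intros)
  then have "closed ?C"
    by (intro closed_Collect_all closed_Collect_conj closed_Collect_le continuous_intros)
  ultimately have "compact ?C" by (simp add: compact_eq_bounded_closed)
  moreover have "invertible A" if "A \<in> ?C" for A
  proof -
    have "v = 0" if "A *v v = 0" for v
      using \<open>A \<in> ?C\<close> that by (metis (mono_tags, lifting) mem_Collect_eq mult_zero_right norm_le_zero_iff norm_zero)
    then show ?thesis
      using invertible_left_inverse matrix_left_invertible_ker by blast
  qed
  ultimately show ?thesis
    unfolding GL_topology_def GL_simps by (auto simp: compactin_subtopology)
qed

text \<open>The target is metrizable, hence Hausdorff and compactly generated, so a continuous map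
  is proper as soon as preimages of compact sets are compact.\<close>

lemma proper_action_GL:
  "proper_action GL_topology (norms.mtopology :: (real^'n \<Rightarrow> real) topology) GL_act"
proof -
  let ?T = "norms.mtopology :: (real^'n \<Rightarrow> real) topology"
  let ?f = "\<lambda>(A, \<eta>). (GL_act A \<eta>, \<eta>) :: (real^'n \<Rightarrow> real) \<times> (real^'n \<Rightarrow> real)"
  have metr: "metrizable_space (prod_topology ?T ?T)"
    by (simp add: metrizable_space_prod_topology norms.metrizable_space_mtopology)
  have kc: "kc_space (prod_topology ?T ?T)"
    using metrizable_imp_Hausdorff_space[OF metr] by (rule Hausdorff_imp_kc_space)
  have f: "?f = (\<lambda>p. ((\<lambda>(A, \<eta>). GL_act A \<eta>) p, snd p))" by auto
  have cont: "continuous_map (prod_topology GL_topology ?T) (prod_topology ?T ?T) ?f"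
    unfolding f continuous_map_paired
    by (intro conjI continuous_map_GL_act continuous_map_snd)
  have bound: "\<exists>R. \<forall>\<eta>\<in>K. norm_dist norm \<eta> \<le> R" if K: "compactin ?T K" for K
  proof -
    obtain \<eta>\<^sub>0 B where *: "K \<subseteq> norms.mcball \<eta>\<^sub>0 B"
      using norms.compactin_imp_mbounded[OF K] by (auto simp: norms.mbounded_def)
    then have "norm_dist norm \<eta> \<le> norm_dist norm \<eta>\<^sub>0 + B" if "\<eta> \<in> K" for \<eta>
      using that norms.triangle[of norm \<eta>\<^sub>0 \<eta>] is_norm_norm by (fastforce simp: all_norms_iff)
    then show ?thesis by blast
  qed
  have "compactin (prod_topology GL_topology ?T) {p \<in> topspace (prod_topology GL_topology ?T). ?f p \<in> K}"
    (is "compactin _ ?P") if K: "compactin (prod_topology ?T ?T) K" for K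
  proof -
    have K12: "compactin ?T (fst ` K)" "compactin ?T (snd ` K)"
      using image_compactin[OF K] continuous_map_fst continuous_map_snd by blast+
    obtain R S where RS: "\<And>\<eta>. \<eta> \<in> fst ` K \<Longrightarrow> norm_dist norm \<eta> \<le> R"
      "\<And>\<eta>. \<eta> \<in> snd ` K \<Longrightarrow> norm_dist norm \<eta> \<le> S"
      using K12[THEN bound] by blast
    let ?C = "{A :: real^'n^'n. \<forall>v. norm (A *v v) \<le> exp (R + S) * norm v \<and>
      norm v \<le> exp (R + S) * norm (A *v v)}"
    \<comment> \<open>If \<eta> and its translate both stay within bounded distance of the Euclidean
      norm, then \<open>A\<close> distorts Euclidean length by a bounded factor, which confines it
      to a compact set.\<close>
    have "?P \<subseteq> ?C \<times> snd ` K"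
    proof
      fix p assume p: "p \<in> ?P"
      then obtain A \<eta> where A\<eta>: "p = (A, \<eta>)" "invertible A" "is_norm \<eta>" "(GL_act A \<eta>, \<eta>) \<in> K"
        by (cases p) (auto simp: GL_topology_def GL_simps all_norms_iff)
      have "\<eta> \<in> snd ` K" "GL_act A \<eta> \<in> fst ` K"
        using A\<eta>(4) by force+
      then have "norm_dist norm \<eta> \<le> S" "norm_dist norm (GL_act A \<eta>) \<le> R"
        using RS by blast+
      then have le: "norm v \<le> exp S * \<eta> v" "\<eta> v \<le> exp S * norm v"
        "norm (A *v v) \<le> exp R * \<eta> v" "\<eta> v \<le> exp R * norm (A *v v)" for v
        using A\<eta>(2,3) GL_act_matrix_vector[OF A\<eta>(2,3), of v]
        by (auto simp: norm_dist_le_iff is_norm_norm is_norm_GL_act dest: spec[of _ "A *v v"])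
      have "norm (A *v v) \<le> exp (R + S) * norm v" "norm v \<le> exp (R + S) * norm (A *v v)" for v
        using order_trans[OF le(3) mult_left_mono[OF le(2)[of v], of "exp R"]]
          order_trans[OF le(1) mult_left_mono[OF le(4)[of v], of "exp S"]]
        by (simp_all add: exp_add mult_ac)
      then show "p \<in> ?C \<times> snd ` K" using \<open>\<eta> \<in> snd ` K\<close> A\<eta>(1) by blast
    qed
    moreover have "compactin (prod_topology GL_topology ?T) (?C \<times> snd ` K)"
      using compactin_GL_quasi_isometries[of "exp (R + S)"] K12(2) unfolding compactin_Times by blast
    moreover have "closedin (prod_topology GL_topology ?T) ?P"
      using cont compactin_imp_closedin_gen[OF kc K] by (rule closedin_continuous_map_preimage)
    ultimately show ?thesis using closed_compactin by blast
  qed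
  then have "proper_map (prod_topology GL_topology ?T) (prod_topology ?T ?T) ?f"
    using metrizable_imp_k_space[OF metr] kc cont
    by (intro compact_imp_proper_map) (auto simp: continuous_map_def)
  then show ?thesis
    unfolding proper_action_def using continuous_map_GL_act by blast
qed

section \<open>Simultaneous diagonalization\<close>

text \<open>The first-order condition at a minimum. In the witness \<open>t\<close>, dividing by
  \<open>1 + \<bar>q\<bar>\<close> avoids the case \<open>q = 0\<close> and makes the quadratic term
  too small to compensate the linear one.\<close>

lemma zero_if_quadratic_nonneg:
  fixes p q :: real
  assumes "\<And>t. 0 \<le> 2 * t * p + t\<^sup>2 * q"
  shows "p = 0"
proof (rule ccontr)
  assume "p \<noteq> 0"
  define t where "t = - p / (1 + \<bar>q\<bar>)"
  have p: "p = - t * (1 + \<bar>q\<bar>)" by (simp add: t_def)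
  then have t: "t \<noteq> 0" using \<open>p \<noteq> 0\<close> by auto
  have "2 * t * p + t\<^sup>2 * q = t\<^sup>2 * (q - 2 * \<bar>q\<bar> - 2)"
    by (subst p) (simp add: power2_eq_square algebra_simps)
  also have "\<dots> < 0" using t by (intro mult_pos_neg) auto
  finally show False using assms[of t] by simp
qed

text \<open>Spectral theorem for \<open>s\<close> relative to \<open>b\<close>: a maximizer of the
  Rayleigh quotient \<open>s x x / b x x\<close> is an eigenvector, and its
  \<open>b\<close>-complement is also \<open>s\<close>-orthogonal to it. The statement for subspaces
  permits induction on the dimension.\<close>

lemma simultaneous_diagonalization_subspace:
  fixes b s :: "real^'n \<Rightarrow> real^'n \<Rightarrow> real"
  assumes b: "is_inner_product b" and s: "bilinear s" "\<And>v w. s v w = s w v"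
    and W: "subspace W"
  shows "\<exists>B. finite B \<and> W \<subseteq> span B \<and> B \<subseteq> W \<and>
    (\<forall>v\<in>B. \<forall>w\<in>B. b v w = (if v = w then 1 else 0)) \<and> (\<forall>v\<in>B. \<forall>w\<in>B. v \<noteq> w \<longrightarrow> s v w = 0)"
  using W
proof (induction "dim W" arbitrary: W rule: less_induct)
  case (less W)
  have bil: "bilinear b" and b_sym: "\<And>v w. b v w = b w v" and b_pos: "\<And>v. v \<noteq> 0 \<Longrightarrow> 0 < b v v"
    using b by (auto simp: is_inner_product_def)
  note bl = bilinear_ladd[OF bil] bilinear_radd[OF bil] bilinear_lmul[OF bil] bilinear_rmul[OF bil]
    bilinear_lsub[OF bil] bilinear_rsub[OF bil] bilinear_lzero[OF bil] bilinear_rzero[OF bil]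
  note sl = bilinear_ladd[OF s(1)] bilinear_radd[OF s(1)] bilinear_lmul[OF s(1)]
    bilinear_rmul[OF s(1)] bilinear_lzero[OF s(1)]
  note W = less.prems
  show ?case
  proof (cases "W \<subseteq> {0}")
    case True
    then show ?thesis using span_zero by (intro exI[of _ "{}"]) auto
  next
    case False
    let ?S = "W \<inter> sphere 0 1"
    obtain w\<^sub>0 where "w\<^sub>0 \<in> W" "w\<^sub>0 \<noteq> 0" using False by blast
    then have "inverse (norm w\<^sub>0) *\<^sub>R w\<^sub>0 \<in> ?S" using W by (simp add: subspace_scale)
    then have "?S \<noteq> {}" by blast
    moreover have "compact ?S"
      by (intro closed_Int_compact closed_subspace W compact_sphere)
    moreover have "continuous_on ?S (\<lambda>x. s x x / b x x)"
    proof (intro continuous_on_divide)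
      show "continuous_on ?S (\<lambda>x. s x x)" "continuous_on ?S (\<lambda>x. b x x)"
        using s(1) bil unfolding bilinear_conv_bounded_bilinear
        by (auto intro: bounded_bilinear.continuous_on continuous_on_id)
      show "\<forall>x\<in>?S. b x x \<noteq> 0"
        by (metis IntD2 b_pos less_irrefl mem_sphere_0 norm_zero zero_neq_one)
    qed
    ultimately obtain u where u: "u \<in> ?S" "\<forall>x\<in>?S. s x x / b x x \<le> s u u / b u u"
      using continuous_attains_sup by blast
    define \<mu> where "\<mu> = s u u / b u u"
    \<comment> \<open>This form is positive semidefinite on \<open>W\<close> and vanishes at
      \<open>u\<close>, so \<open>u\<close> lies in its radical:
      \<open>s u w = \<mu> * b u w\<close> for all \<open>w\<close> in \<open>W\<close>.\<close>
    define q where "q x y = \<mu> * b x y - s x y" for x y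
    have "u \<noteq> 0" using u(1) by auto
    have uW: "u \<in> W" and bu: "0 < b u u" using u(1) b_pos[OF \<open>u \<noteq> 0\<close>] by auto
    have q_nonneg: "0 \<le> q x x" if "x \<in> W" for x
    proof (cases "x = 0")
      case False
      let ?x = "inverse (norm x) *\<^sub>R x"
      have "?x \<in> ?S" using that False W by (simp add: subspace_scale)
      then have "s ?x ?x / b ?x ?x \<le> \<mu>" using u(2) by (simp add: \<mu>_def)
      moreover have "s ?x ?x / b ?x ?x = s x x / b x x"
        using False by (simp add: bl sl)
      ultimately have "s x x / b x x \<le> \<mu>" by simp
      then show ?thesis using b_pos[OF False] by (simp add: q_def divide_le_eq)
    qed (simp add: q_def bl sl)
    have q_uu: "q u u = 0" using bu by (simp add: q_def \<mu>_def)
    have q_u: "q u w = 0" if "w \<in> W" for w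
    proof (rule zero_if_quadratic_nonneg)
      fix t
      have "u + t *\<^sub>R w \<in> W" using uW that W by (simp add: subspace_add subspace_scale)
      then have "0 \<le> q (u + t *\<^sub>R w) (u + t *\<^sub>R w)" by (rule q_nonneg)
      also have "\<dots> = q u u + 2 * t * q u w + t\<^sup>2 * q w w"
        by (simp add: q_def bl sl b_sym[of w u] s(2)[of w u] power2_eq_square algebra_simps)
      finally show "0 \<le> 2 * t * q u w + t\<^sup>2 * q w w" by (simp add: q_uu)
    qed
    define e where "e = inverse (sqrt (b u u)) *\<^sub>R u"
    have eW: "e \<in> W" using uW W by (simp add: e_def subspace_scale)
    have bee: "b e e = 1"
      using bu by (simp add: e_def bl field_simps)
    have s_e: "s e w = 0" if "w \<in> W" "b e w = 0" for w
      using q_u[OF that(1)] that(2) bu by (simp add: e_def bl sl q_def)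
    let ?W' = "{w \<in> W. b e w = 0}"
    have W': "subspace ?W'"
      using W by (auto simp: subspace_def bl)
    have "e \<notin> ?W'" using bee by simp
    then have "?W' \<subset> W" using eW by blast
    then have "dim ?W' < dim W"
      using W W' by (intro dim_psubset) (simp add: span_eq_iff[THEN iffD2])
    from less.hyps[OF this W'] obtain B where B: "finite B" "?W' \<subseteq> span B" "B \<subseteq> ?W'"
      "\<forall>v\<in>B. \<forall>w\<in>B. b v w = (if v = w then 1 else 0)"
      "\<forall>v\<in>B. \<forall>w\<in>B. v \<noteq> w \<longrightarrow> s v w = 0" by blast
    have "w \<in> span (insert e B)" if "w \<in> W" for w
    proof -
      have "w - b e w *\<^sub>R e \<in> ?W'"
        using that eW W bee by (simp add: subspace_diff subspace_scale bl)
      then show ?thesis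
        using B(2) by (auto simp: span_insert)
    qed
    moreover have "b v w = (if v = w then 1 else 0)" if "v \<in> insert e B" "w \<in> insert e B" for v w
    proof -
      have 0: "b e x = 0" "b x e = 0" "x \<noteq> e" if "x \<in> B" for x
        using that B(3) bee b_sym[of x e] by auto
      show ?thesis using that B(4) bee 0 by (cases "v = e"; cases "w = e") auto
    qed
    moreover have "s v w = 0" if "v \<in> insert e B" "w \<in> insert e B" "v \<noteq> w" for v w
    proof -
      have 0: "s e x = 0" "s x e = 0" if "x \<in> B" for x
        using that B(3) s_e[of x] s(2)[of x e] by auto
      show ?thesis using that B(5) 0 by (cases "v = e"; cases "w = e") auto
    qed
    moreover have "finite (insert e B)" "insert e B \<subseteq> W" using B(1,3) eW by auto
    ultimately show ?thesis by (intro exI[of _ "insert e B"]) auto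
  qed
qed

text \<open>\<open>s\<close> may be indefinite because it will be either a second inner product or
  the form of a tangent vector. Orthonormality yields independence, so the basis can be indexed by
  \<open>'n\<close>.\<close>

lemma simultaneous_diagonalization:
  fixes b s :: "real^'n \<Rightarrow> real^'n \<Rightarrow> real"
  assumes b: "is_inner_product b" and s: "bilinear s" "\<And>v w. s v w = s w v"
  obtains v :: "'n \<Rightarrow> real^'n" where "is_basis v"
    "\<And>i j. b (v i) (v j) = (if i = j then 1 else 0)" "\<And>i j. i \<noteq> j \<Longrightarrow> s (v i) (v j) = 0"
proof -
  obtain B where B: "finite B" "UNIV \<subseteq> span B"
    "\<forall>v\<in>B. \<forall>w\<in>B. b v w = (if v = w then 1 else 0)" "\<forall>v\<in>B. \<forall>w\<in>B. v \<noteq> w \<longrightarrow> s v w = 0"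
    using simultaneous_diagonalization_subspace[OF assms subspace_UNIV] by blast
  have lin: "linear (\<lambda>x. b x w)" for w
    using b by (simp add: is_inner_product_def bilinear_def)
  have "independent B"
  proof
    assume "dependent B"
    then obtain f w where f: "w \<in> B" "f w \<noteq> 0" "(\<Sum>v\<in>B. f v *\<^sub>R v) = 0"
      using B(1) by (auto simp: dependent_finite)
    have "0 = b (\<Sum>v\<in>B. f v *\<^sub>R v) w"
      using linear_0[OF lin] by (simp add: f(3))
    also have "\<dots> = (\<Sum>v\<in>B. f v * b v w)"
      by (simp add: linear_sum[OF lin] linear_scale[OF lin])
    also have "\<dots> = (\<Sum>v\<in>B. if v = w then f v else 0)"
      using B(3) f(1) by (intro sum.cong) auto
    also have "\<dots> = f w" using B(1) f(1) by simp
    finally show False using f(2) by simp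
  qed
  then have "card B = CARD('n)"
    using B(2) dim_eq_card_independent[of B] dim_span[of B] by (simp add: top.extremum_unique)
  then obtain v where v: "bij_betw v (UNIV :: 'n set) B"
    using finite_same_card_bij[of "UNIV :: 'n set" B] B(1) by auto
  then have inj: "inj v" and range: "range v = B" by (auto simp: bij_betw_def)
  show thesis
  proof
    show "is_basis v"
      using inj \<open>independent B\<close> B(2) by (auto simp: is_basis_def range)
    show "b (v i) (v j) = (if i = j then 1 else 0)" for i j
      using B(3) inj by (auto simp: range[symmetric] inj_eq)
    show "s (v i) (v j) = 0" if "i \<noteq> j" for i j
      using B(4) inj that by (auto simp: range[symmetric] inj_eq)
  qed
qed

section \<open>Flats\<close>

lemma has_vector_derivative_vec_lambda:
  fixes f :: "real \<Rightarrow> 'n::finite \<Rightarrow> 'b::euclidean_space"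
  assumes "\<And>i. ((\<lambda>t. f t i) has_vector_derivative f' i) (at t)"
  shows "((\<lambda>t. \<chi> i. f t i) has_vector_derivative (\<chi> i. f' i)) (at t)"
  unfolding has_vector_derivative_def has_derivative_componentwise_within[of "\<lambda>t. \<chi> i. f t i"]
proof
  fix u :: "'b^'n" assume "u \<in> Basis"
  then obtain i w where u: "u = axis i w" by (auto simp: Basis_vec_def)
  have "((\<lambda>t. f t i \<bullet> w) has_derivative (\<lambda>x. (x *\<^sub>R f' i) \<bullet> w)) (at t)"
    using assms[of i] unfolding has_vector_derivative_def by (rule has_derivative_inner_left)
  then show "((\<lambda>t. (\<chi> i. f t i) \<bullet> u) has_derivative (\<lambda>x. (x *\<^sub>R (\<chi> i. f' i)) \<bullet> u)) (at t)"
    by (simp add: u inner_axis)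
qed

definition coord :: "('n \<Rightarrow> real^'n) \<Rightarrow> 'n \<Rightarrow> real^'n \<Rightarrow> real" where
  "coord v i x = representation (range v) x (v i)"

text \<open>The matrix, in the standard basis, of the quadratic form with diagonal entries \<open>w\<close> in the basis \<open>v\<close>.\<close>

definition diag_form :: "('n \<Rightarrow> real^'n) \<Rightarrow> ('n \<Rightarrow> real) \<Rightarrow> real^'n^'n" where
  "diag_form v w = (\<chi> i j. \<Sum>k\<in>UNIV. w k * coord v k (axis i 1) * coord v k (axis j 1))"

context
  fixes v :: "'n::finite \<Rightarrow> real^'n"
  assumes v: "is_basis v"
begin

lemma linear_coord: "linear (coord v i)"
  using v by (intro linearI) (simp_all add: coord_def is_basis_def representation_add representation_scale)

lemma coord_basis: "coord v i (v j) = (if i = j then 1 else 0)"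
  using v by (auto simp: coord_def is_basis_def representation_basis inj_eq)

lemma sum_coord: "(\<Sum>i\<in>UNIV. coord v i x *\<^sub>R v i) = x"
proof -
  have "(\<Sum>i\<in>UNIV. coord v i x *\<^sub>R v i) = (\<Sum>w\<in>range v. representation (range v) x w *\<^sub>R w)"
    using v by (simp add: sum.reindex is_basis_def coord_def)
  also have "\<dots> = x"
    using v by (intro sum_representation_eq) (auto simp: is_basis_def)
  finally show ?thesis .
qed

lemma coord_standard_basis: "coord v k x = (\<Sum>i\<in>UNIV. x $ i * coord v k (axis i 1))"
proof -
  have "coord v k x = coord v k (\<Sum>i\<in>UNIV. (x $ i) *\<^sub>R axis i 1)"
    by (simp add: basis_expansion[of x, unfolded scalar_mult_eq_scaleR])
  also have "\<dots> = (\<Sum>i\<in>UNIV. x $ i * coord v k (axis i 1))"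
    by (simp add: linear_sum[OF linear_coord] linear_scale[OF linear_coord])
  finally show ?thesis .
qed

lemma bilinear_diagonal:
  assumes "bilinear s" "\<And>i j. i \<noteq> j \<Longrightarrow> s (v i) (v j) = (0::real)"
  shows "s x y = (\<Sum>i\<in>UNIV. s (v i) (v i) * coord v i x * coord v i y)"
proof -
  have "s x y = s (\<Sum>i\<in>UNIV. coord v i x *\<^sub>R v i) (\<Sum>j\<in>UNIV. coord v j y *\<^sub>R v j)"
    by (simp add: sum_coord)
  also have "\<dots> = (\<Sum>i\<in>UNIV. \<Sum>j\<in>UNIV. coord v i x * (coord v j y * s (v i) (v j)))"
    by (simp add: bilinear_sum[OF assms(1)] sum.cartesian_product bilinear_lmul[OF assms(1)]
        bilinear_rmul[OF assms(1)] mult_ac)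
  also have "\<dots> = (\<Sum>i\<in>UNIV. \<Sum>j\<in>UNIV. if j = i then s (v i) (v i) * coord v i x * coord v i y else 0)"
    using assms(2) by (intro sum.cong) auto
  finally show ?thesis by simp
qed

lemma flat_power2: "(flat v m x)\<^sup>2 = (\<Sum>i\<in>UNIV. exp (2 * m $ i) * (coord v i x)\<^sup>2)"
  by (simp add: flat_def coord_def sum_nonneg)

lemma flat_basis: "flat v m (v i) = exp (m $ i)"
proof -
  have "(flat v m (v i))\<^sup>2 = (\<Sum>j\<in>UNIV. if j = i then exp (2 * m $ j) else 0)"
    unfolding flat_power2 by (intro sum.cong) (simp_all add: coord_basis)
  also have "\<dots> = (exp (m $ i))\<^sup>2" by (simp add: exp_double)
  finally show ?thesis
    by (rule power2_eq_imp_eq) (simp_all add: flat_def sum_nonneg)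
qed

lemma flat_mem: "flat v m \<in> euclidean_norms" "is_norm (flat v m)"
proof -
  define L :: "real^'n \<Rightarrow> real^'n" where "L x = (\<chi> i. exp (m $ i) * coord v i x)" for x
  have "linear L"
    by (rule linearI)
      (simp_all add: L_def vec_eq_iff linear_add[OF linear_coord] linear_scale[OF linear_coord] distrib_left)
  moreover have "x = 0" if "L x = 0" for x
    using that sum_coord[of x] by (simp add: L_def vec_eq_iff)
  moreover have "flat v m = (\<lambda>x. norm (L x))"
    by (simp add: flat_def coord_def L_def norm_vec_def L2_set_def power_mult_distrib exp_double)
  ultimately show "flat v m \<in> euclidean_norms" "is_norm (flat v m)"
    using norm_linear_in_euclidean_norms[of L] is_norm_norm_linear[of L] by auto
qed

lemma diag_form_quadratic: "x \<bullet> (diag_form v w *v x) = (\<Sum>k\<in>UNIV. w k * (coord v k x)\<^sup>2)"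
proof -
  have "x \<bullet> (diag_form v w *v x) = (\<Sum>i\<in>UNIV. \<Sum>j\<in>UNIV. \<Sum>k\<in>UNIV.
      w k * ((x $ i * coord v k (axis i 1)) * (x $ j * coord v k (axis j 1))))"
    by (simp add: inner_vec_def matrix_vector_mult_def diag_form_def sum_distrib_left
        sum_distrib_right mult_ac)
  also have "\<dots> = (\<Sum>k\<in>UNIV. \<Sum>i\<in>UNIV. \<Sum>j\<in>UNIV.
      w k * ((x $ i * coord v k (axis i 1)) * (x $ j * coord v k (axis j 1))))"
    by (subst (2) sum.swap, subst sum.swap) (rule refl)
  also have "\<dots> = (\<Sum>k\<in>UNIV. w k * (coord v k x)\<^sup>2)"
    by (simp only: coord_standard_basis[of _ x] power2_eq_square sum_product)
      (simp only: sum_distrib_left)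
  finally show ?thesis .
qed

lemma gram_flat: "gram (flat v m) = diag_form v (\<lambda>k. exp (2 * m $ k))"
proof -
  have "(flat v m (x + y))\<^sup>2 - (flat v m x)\<^sup>2 - (flat v m y)\<^sup>2
      = 2 * (\<Sum>k\<in>UNIV. exp (2 * m $ k) * coord v k x * coord v k y)" for x y
    unfolding flat_power2 sum_subtractf[symmetric] sum_distrib_left
    by (intro sum.cong) (simp_all add: linear_add[OF linear_coord] power2_eq_square algebra_simps)
  then show ?thesis by (simp add: gram_def diag_form_def vec_eq_iff)
qed

lemma gram_flat_has_vector_derivative:
  "((\<lambda>t. gram (flat v (m + t *\<^sub>R a))) has_vector_derivative
     diag_form v (\<lambda>k. 2 * a $ k * exp (2 * (m + t *\<^sub>R a) $ k))) (at t)"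
proof -
  have "((\<lambda>t. exp (2 * (m $ k + t * a $ k)) * c) has_vector_derivative
      2 * a $ k * exp (2 * (m $ k + t * a $ k)) * c) (at t)" for k c
    by (auto intro!: derivative_eq_intros simp flip: has_real_derivative_iff_has_vector_derivative)
  then show ?thesis
    unfolding gram_flat diag_form_def
    by (auto simp: mult.assoc intro!: has_vector_derivative_vec_lambda has_vector_derivative_sum)
qed

end

section \<open>The Finsler norm\<close>

lemma infnorm_attained:
  fixes a :: "real^'n"
  obtains k where "infnorm a = \<bar>a $ k\<bar>"
proof -
  have "infnorm a \<in> (\<lambda>i. \<bar>a \<bullet> i\<bar>) ` Basis"
    unfolding infnorm_Max by (rule Max_in) auto
  then show thesis using that by (auto simp: Basis_vec_def inner_axis)
qed

text \<open>The predicate under the definite description in \<open>finsler_norm\<close>, without the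
  value; naming it separates existence of a flat from uniqueness of the value.\<close>

definition tangent_to_flat ::
  "(real^'n \<Rightarrow> real) \<Rightarrow> real^'n^'n \<Rightarrow> ('n \<Rightarrow> real^'n) \<Rightarrow> real^'n \<Rightarrow> real^'n \<Rightarrow> bool" where
  "tangent_to_flat \<eta> S v m a \<longleftrightarrow> is_basis v \<and> \<eta> = flat v m \<and>
     ((\<lambda>t. gram (flat v (m + t *\<^sub>R a))) has_vector_derivative S) (at 0)"

text \<open>
  Twice \<open>infnorm a\<close> is the supremum over \<open>x\<close> of the absolute logarithmic derivative of \<open>(\<eta> x)\<^sup>2\<close> in
  direction \<open>S\<close>, and therefore independent of the flat.
\<close>

lemma tangent_to_flat_quadratic_le:
  assumes "tangent_to_flat \<eta> S v m a"
  shows "\<bar>x \<bullet> (S *v x)\<bar> \<le> 2 * infnorm a * (\<eta> x)\<^sup>2"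
    and "\<exists>x. x \<noteq> 0 \<and> \<bar>x \<bullet> (S *v x)\<bar> = 2 * infnorm a * (\<eta> x)\<^sup>2"
proof -
  have v: "is_basis v" and \<eta>: "\<eta> = flat v m"
    using assms by (auto simp: tangent_to_flat_def)
  have "S = diag_form v (\<lambda>k. 2 * a $ k * exp (2 * (m + 0 *\<^sub>R a) $ k))"
    using assms gram_flat_has_vector_derivative[OF v, of m a 0] vector_derivative_unique_at
    unfolding tangent_to_flat_def by blast
  then have S: "x \<bullet> (S *v x) = (\<Sum>k\<in>UNIV. 2 * a $ k * exp (2 * m $ k) * (coord v k x)\<^sup>2)" for x
    by (simp add: diag_form_quadratic[OF v])
  have "\<bar>x \<bullet> (S *v x)\<bar> \<le> (\<Sum>k\<in>UNIV. \<bar>2 * a $ k * exp (2 * m $ k) * (coord v k x)\<^sup>2\<bar>)"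
    unfolding S by (rule sum_abs)
  also have "\<dots> \<le> (\<Sum>k\<in>UNIV. 2 * infnorm a * (exp (2 * m $ k) * (coord v k x)\<^sup>2))"
    using component_le_infnorm_cart[of a]
    by (intro sum_mono) (simp add: abs_mult mult_right_mono)
  also have "\<dots> = 2 * infnorm a * (\<eta> x)\<^sup>2"
    by (simp add: \<eta> flat_power2[OF v] sum_distrib_left)
  finally show "\<bar>x \<bullet> (S *v x)\<bar> \<le> 2 * infnorm a * (\<eta> x)\<^sup>2" .
  \<comment> \<open>Equality holds at the basis vector of a coordinate in which \<open>a\<close> is
    largest in absolute value.\<close>
  obtain k where k: "infnorm a = \<bar>a $ k\<bar>" by (rule infnorm_attained)
  have "v k \<bullet> (S *v v k) = (\<Sum>i\<in>UNIV. if i = k then 2 * a $ k * exp (2 * m $ k) else 0)"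
    unfolding S by (intro sum.cong) (simp_all add: coord_basis[OF v])
  then have "\<bar>v k \<bullet> (S *v v k)\<bar> = 2 * infnorm a * (\<eta> (v k))\<^sup>2"
    by (simp add: k \<eta> flat_basis[OF v] abs_mult exp_double)
  moreover have "v k \<noteq> 0"
    using coord_basis[OF v, of k k] linear_0[OF linear_coord[OF v, of k]] by auto
  ultimately show "\<exists>x. x \<noteq> 0 \<and> \<bar>x \<bullet> (S *v x)\<bar> = 2 * infnorm a * (\<eta> x)\<^sup>2" by blast
qed

text \<open>The description requires uniqueness across all flats. A vector that is extremal for one
  flat, inserted into the bound for another, gives one inequality; the other follows by
  symmetry.\<close>

lemma finsler_norm_eq_infnorm:
  assumes "tangent_to_flat \<eta> S v m a"
  shows "finsler_norm \<eta> S = infnorm a"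
proof -
  have le: "infnorm a \<le> infnorm a'"
    if t: "tangent_to_flat \<eta> S v m a" and t': "tangent_to_flat \<eta> S v' m' a'" for v m a v' m' a'
  proof -
    obtain x where x: "x \<noteq> 0" "\<bar>x \<bullet> (S *v x)\<bar> = 2 * infnorm a * (\<eta> x)\<^sup>2"
      using tangent_to_flat_quadratic_le(2)[OF t] by blast
    have "is_norm \<eta>"
      using t flat_mem(2) by (auto simp: tangent_to_flat_def)
    then have "0 < (\<eta> x)\<^sup>2" using is_norm_pos[OF _ x(1)] by force
    moreover have "2 * infnorm a * (\<eta> x)\<^sup>2 \<le> 2 * infnorm a' * (\<eta> x)\<^sup>2"
      using tangent_to_flat_quadratic_le(1)[OF t', of x] x(2) by simp
    ultimately show ?thesis by simp
  qed
  have "finsler_norm \<eta> S = (THE r. \<exists>v m a. tangent_to_flat \<eta> S v m a \<and> r = infnorm a)"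
    unfolding finsler_norm_def tangent_to_flat_def by (simp add: conj_assoc)
  also have "\<dots> = infnorm a"
    using assms le by (intro the_equality) (blast intro: order_antisym)+
  finally show ?thesis .
qed

lemma sqrt_diagonal_eq_flat:
  assumes v: "is_basis v" "bilinear s" "\<And>i j. i \<noteq> j \<Longrightarrow> s (v i) (v j) = 0"
    and m: "\<And>i. s (v i) (v i) = exp (2 * m $ i)"
  shows "(\<lambda>x. sqrt (s x x)) = flat v m"
proof
  show "sqrt (s x x) = flat v m x" for x
    unfolding flat_def by (subst bilinear_diagonal[OF v]) (simp_all add: m coord_def power2_eq_square mult.assoc)
qed

text \<open>Diagonalizing the second inner product in an orthonormal basis of the first puts the
  first norm at the origin of the flat.\<close>

lemma euclidean_norms_common_flat:
  assumes "\<eta> \<in> euclidean_norms" "\<xi> \<in> euclidean_norms"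
  obtains v a where "is_basis v" "\<eta> = flat v 0" "\<xi> = flat v a"
proof -
  obtain b s where b: "is_inner_product b" "\<eta> = (\<lambda>x. sqrt (b x x))"
    and s: "is_inner_product s" "\<xi> = (\<lambda>x. sqrt (s x x))"
    using assms by (auto simp: euclidean_norms_def)
  have bil: "bilinear b" "bilinear s" and sym: "\<And>x y. s x y = s y x"
    and pos: "\<And>x. x \<noteq> 0 \<Longrightarrow> 0 < s x x"
    using b(1) s(1) by (auto simp: is_inner_product_def)
  obtain v where v: "is_basis v" "\<And>i j. b (v i) (v j) = (if i = j then 1 else 0)"
    "\<And>i j. i \<noteq> j \<Longrightarrow> s (v i) (v j) = 0"
    using simultaneous_diagonalization[OF b(1) bil(2) sym] by blast
  have v0: "v i \<noteq> 0" for i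
    using v(2)[of i i] bilinear_lzero[OF bil(1)] by auto
  \<comment> \<open>Half the logarithm, since \<open>flat\<close> squares to a form with entries
    \<open>exp (2 * a $ i)\<close>.\<close>
  define a :: "real^'a" where "a = (\<chi> i. ln (s (v i) (v i)) / 2)"
  have "\<xi> = flat v a"
    unfolding s(2) using pos[OF v0] v bil(2) by (intro sqrt_diagonal_eq_flat) (simp_all add: a_def)
  moreover have "\<eta> = flat v 0"
    unfolding b(2) using v bil(1) by (intro sqrt_diagonal_eq_flat) simp_all
  ultimately show thesis using v(1) that by blast
qed

lemma euclidean_norms_subset: "euclidean_norms \<subseteq> all_norms"
proof
  fix \<eta> :: "real^'n \<Rightarrow> real" assume "\<eta> \<in> euclidean_norms"
  then obtain v where "is_basis v" "\<eta> = flat v 0"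
    using euclidean_norms_common_flat by blast
  then show "\<eta> \<in> all_norms" using flat_mem(2) by (simp add: all_norms_iff)
qed

lemma gram_quadratic: "\<eta> \<in> euclidean_norms \<Longrightarrow> x \<bullet> (gram \<eta> *v x) = (\<eta> x)\<^sup>2"
  by (rule euclidean_norms_common_flat[of \<eta> \<eta>])
    (simp_all add: gram_flat diag_form_quadratic flat_power2)

text \<open>Diagonalizing \<open>S\<close> relative to \<eta> produces the flat, so the Finsler norm
  is meaningful for every symmetric velocity.\<close>

lemma exists_tangent_to_flat:
  fixes S :: "real^'n^'n"
  assumes "\<eta> \<in> euclidean_norms" and S: "\<And>i j. S $ i $ j = S $ j $ i"
  obtains v m a where "tangent_to_flat \<eta> S v m a"
proof -
  obtain b where b: "is_inner_product b" "\<eta> = (\<lambda>x. sqrt (b x x))"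
    using assms by (auto simp: euclidean_norms_def)
  have bil: "bilinear b" using b(1) by (simp add: is_inner_product_def)
  define s where "s x y = x \<bullet> (S *v y)" for x y
  have bil_s: "bilinear s"
    unfolding bilinear_def s_def
    by (auto intro!: linearI simp: inner_add_left inner_add_right matrix_vector_right_distrib
        matrix_vector_mult_scaleR)
  have "transpose S = S" by (simp add: transpose_def vec_eq_iff S)
  then have sym: "s x y = s y x" for x y
    unfolding s_def by (metis dot_lmul_matrix inner_commute transpose_matrix_vector)
  obtain v where v: "is_basis v" "\<And>i j. b (v i) (v j) = (if i = j then 1 else 0)"
    "\<And>i j. i \<noteq> j \<Longrightarrow> s (v i) (v j) = 0"
    using simultaneous_diagonalization[OF b(1) bil_s sym] by blast
  \<comment> \<open>The derivative of \<open>exp (2 * t * a $ i)\<close> at 0 is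
    \<open>2 * a $ i\<close>, whence the division by 2.\<close>
  define a :: "real^'n" where "a = (\<chi> i. s (v i) (v i) / 2)"
  have "\<eta> = flat v 0"
    unfolding b(2) using v bil by (intro sqrt_diagonal_eq_flat) simp_all
  moreover have "diag_form v (\<lambda>k. 2 * a $ k * exp (2 * (0 + 0 *\<^sub>R a) $ k)) = S"
  proof -
    have "S $ i $ j = s (axis i 1) (axis j 1)" for i j
      by (simp add: s_def matrix_vector_mult_basis inner_axis' column_def)
    moreover have "s x y = (\<Sum>k\<in>UNIV. 2 * a $ k * coord v k x * coord v k y)" for x y
      by (subst bilinear_diagonal[OF v(1) bil_s v(3)]) (simp_all add: a_def)
    ultimately show ?thesis by (simp add: diag_form_def vec_eq_iff)
  qed
  ultimately have "tangent_to_flat \<eta> S v 0 a"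
    using gram_flat_has_vector_derivative[OF v(1), of 0 a 0] v(1) by (simp add: tangent_to_flat_def)
  then show thesis using that by blast
qed

lemma quadratic_le_finsler_norm:
  assumes "\<eta> \<in> euclidean_norms" "\<And>i j. S $ i $ j = S $ j $ i"
  shows "\<bar>x \<bullet> (S *v x)\<bar> \<le> 2 * finsler_norm \<eta> S * (\<eta> x)\<^sup>2"
proof -
  obtain v m a where "tangent_to_flat \<eta> S v m a"
    using exists_tangent_to_flat[OF assms] by blast
  then show ?thesis
    using tangent_to_flat_quadratic_le(1) by (simp add: finsler_norm_eq_infnorm)
qed

section \<open>The Finsler distance\<close>

lemma bounded_linear_matrix_quadratic: "bounded_linear (\<lambda>M :: real^'n^'n. x \<bullet> (M *v x))"
  unfolding linear_conv_bounded_linear[symmetric]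
  by (rule linearI)
    (simp_all add: matrix_vector_mult_add_rdistrib inner_add_right scaleR_matrix_vector_assoc[symmetric])

lemma abs_ln_le_path_length:
  assumes c: "path_length c L" and "x \<noteq> 0"
  shows "\<bar>ln (c 1 x / c 0 x)\<bar> \<le> L"
proof -
  let ?p = "\<lambda>t. gram (c t)"
  let ?p' = "\<lambda>t. vector_derivative ?p (at t)"
  define q where "q M = x \<bullet> (M *v x)" for M :: "real^'a^'a"
  have q: "bounded_linear q" unfolding q_def by (rule bounded_linear_matrix_quadratic)
  have euc: "c t \<in> euclidean_norms" if "t \<in> {0..1}" for t
    using c that by (auto simp: path_length_def)
  have pos: "0 < c t x" if "t \<in> {0..1}" for t
  proof -
    have "is_norm (c t)" using euc[OF that] euclidean_norms_subset by (auto simp: all_norms_iff)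
    then show ?thesis using \<open>x \<noteq> 0\<close> by (rule is_norm_pos)
  qed
  have q_gram: "q (?p t) = (c t x)\<^sup>2" if "t \<in> {0..1}" for t
    using euc[OF that] by (simp add: q_def gram_quadratic)
  have "?p piecewise_C1_differentiable_on {0..1}"
    using c by (simp add: path_length_def valid_path_def)
  then obtain S where S: "finite S" "?p C1_differentiable_on ({0..1} - S)" and cont: "continuous_on {0..1} ?p"
    by (auto simp: piecewise_C1_differentiable_on_def)
  have deriv: "(?p has_vector_derivative ?p' t) (at t)" if "t \<in> {0..1} - S" for t
    using S(2) that by (auto simp: C1_differentiable_on_eq vector_derivative_works)
  \<comment> \<open>On [0,1] this is \<open>ln (c t x)\<close>. Writing it through the Gram matrix
    makes it a function of the differentiable curve composed with a linear map; the factor 1/2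
    undoes the square.\<close>
  define F where "F t = ln (q (?p t)) / 2" for t
  define F' where "F' t = q (?p' t) / (2 * (c t x)\<^sup>2)" for t
  have "(F' has_integral F 1 - F 0) {0..1}"
  proof (rule fundamental_theorem_of_calculus_interior_strong[OF S(1)])
    fix t assume t: "t \<in> {0<..<1} - S"
    have "((\<lambda>t. q (?p t)) has_vector_derivative q (?p' t)) (at t)"
      using deriv t by (intro bounded_linear.has_vector_derivative[OF q]) auto
    then have "((\<lambda>t. q (?p t)) has_real_derivative q (?p' t)) (at t)"
      by (simp add: has_real_derivative_iff_has_vector_derivative)
    then have "(F has_real_derivative F' t) (at t)"
      unfolding F_def F'_def using t pos[of t] q_gram[of t]
      by (auto intro!: derivative_eq_intros simp: field_simps)
    then show "(F has_vector_derivative F' t) (at t)"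
      by (simp add: has_real_derivative_iff_has_vector_derivative)
  next
    show "continuous_on {0..1} F"
      unfolding F_def using pos q_gram
      by (intro continuous_intros bounded_linear.continuous_on[OF q] cont) force+
  qed simp
  moreover have "F 1 - F 0 = ln (c 1 x / c 0 x)"
    using pos[of 0] pos[of 1] by (simp add: F_def q_gram ln_realpow ln_div)
  ultimately have F': "(F' has_integral ln (c 1 x / c 0 x)) {0..1}" by simp
  \<comment> \<open>At the finitely many exceptional points the integrand is replaced by
    \<open>\<bar>F' t\<bar>\<close>, so that the comparison holds on all of [0,1] and the integral
    is unchanged.\<close>
  define G where "G t = (if t \<in> S then \<bar>F' t\<bar> else finsler_norm (c t) (?p' t))" for t
  have "((\<lambda>t. finsler_norm (c t) (?p' t)) has_integral L) {0..1}"
    using c by (simp add: path_length_def)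
  then have G: "(G has_integral L) {0..1}"
    by (rule has_integral_spike_finite[OF S(1), rotated]) (simp add: G_def)
  have F'_le: "\<bar>F' t\<bar> \<le> G t" if t: "t \<in> {0..1}" for t
  proof (cases "t \<in> S")
    case False
    \<comment> \<open>Gram matrices are symmetric, hence so is the velocity, which therefore is
      tangent to some flat.\<close>
    have sym: "?p' t $ i $ j = ?p' t $ j $ i" for i j
    proof -
      have d: "((\<lambda>t. ?p t $ i $ j) has_vector_derivative ?p' t $ i $ j) (at t)" for i j
        using deriv[of t] t False
        by (intro bounded_linear.has_vector_derivative[OF bounded_linear_vec_nth]) auto
      have "(\<lambda>t. ?p t $ j $ i) = (\<lambda>t. ?p t $ i $ j)"
        by (rule ext) (simp add: gram_def add.commute[of "axis j 1"])
      then show ?thesis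
        using vector_derivative_unique_at[OF d[of i j]] d[of j i] by simp
    qed
    show ?thesis
      using quadratic_le_finsler_norm[OF euc[OF t] sym, of x] pos[OF t] False
      by (simp add: G_def F'_def q_def abs_divide divide_le_eq mult_ac)
  qed (simp add: G_def)
  have "ln (c 1 x / c 0 x) \<le> L"
    using F' G F'_le by (intro has_integral_le[OF F' G]) (simp add: abs_le_iff)
  moreover have "- ln (c 1 x / c 0 x) \<le> L"
    using F'_le by (intro has_integral_le[OF has_integral_neg[OF F'] G]) (simp add: abs_le_iff)
  ultimately show ?thesis by simp
qed

lemma norm_dist_le_path_length:
  assumes "path_length c L"
  shows "norm_dist (c 0) (c 1) \<le> L"
proof -
  have euc: "c 0 \<in> euclidean_norms" "c 1 \<in> euclidean_norms"
    using assms by (auto simp: path_length_def)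
  then have norms: "is_norm (c 0)" "is_norm (c 1)"
    using euclidean_norms_subset by (auto simp: all_norms_iff)
  have "c 1 x \<le> exp L * c 0 x \<and> c 0 x \<le> exp L * c 1 x" for x
  proof (cases "x = 0")
    case False
    then show ?thesis
      using abs_ln_le_path_length[OF assms False] norms[THEN is_norm_pos, OF False]
      by (simp add: abs_ln_divide_le_iff)
  qed (use is_norm_eq_0_iff[OF norms(1), of 0] is_norm_eq_0_iff[OF norms(2), of 0] in simp)
  then show ?thesis by (simp add: norm_dist_le_iff[OF norms])
qed

text \<open>At each time the velocity points along the same flat in the same direction
  \<open>a\<close>, so the speed is constantly \<open>infnorm a\<close>.\<close>

lemma path_length_flat:
  assumes v: "is_basis v"
  shows "path_length (\<lambda>t. flat v (t *\<^sub>R a)) (infnorm a)"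
  unfolding path_length_def
proof (intro conjI ballI)
  let ?p = "\<lambda>t. gram (flat v (t *\<^sub>R a))"
  let ?p' = "\<lambda>t. diag_form v (\<lambda>k. 2 * a $ k * exp (2 * (t *\<^sub>R a) $ k))"
  have deriv: "(?p has_vector_derivative ?p' t) (at t)" for t
    using gram_flat_has_vector_derivative[OF v, of 0 a t] by simp
  have "continuous_on {0..1} ?p'"
    unfolding diag_form_def by (intro continuous_intros)
  then show "valid_path ?p"
    unfolding valid_path_def using deriv
    by (intro C1_differentiable_imp_piecewise, unfold C1_differentiable_on_def)
      (intro exI[of _ ?p'] conjI ballI)
  have "finsler_norm (flat v (t *\<^sub>R a)) (vector_derivative ?p (at t)) = infnorm a" for t
  proof (rule finsler_norm_eq_infnorm)
    show "tangent_to_flat (flat v (t *\<^sub>R a)) (vector_derivative ?p (at t)) v (t *\<^sub>R a) a"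
      using gram_flat_has_vector_derivative[OF v, of "t *\<^sub>R a" a 0] v
      by (simp add: tangent_to_flat_def vector_derivative_at[OF deriv])
  qed
  then show "((\<lambda>t. finsler_norm (flat v (t *\<^sub>R a)) (vector_derivative ?p (at t)))
      has_integral infnorm a) {0..1}"
    using has_integral_const_real[of "infnorm a" 0 1] by simp
qed (rule flat_mem(1)[OF v])

lemma infnorm_le_norm_dist_flat:
  assumes v: "is_basis v"
  shows "infnorm a \<le> norm_dist (flat v 0) (flat v a)"
proof -
  obtain k where k: "infnorm a = \<bar>a $ k\<bar>" by (rule infnorm_attained)
  have "v k \<noteq> 0"
    using coord_basis[OF v, of k k] linear_0[OF linear_coord[OF v, of k]] by auto
  then have "\<bar>ln (flat v 0 (v k) / flat v a (v k))\<bar> \<le> norm_dist (flat v 0) (flat v a)"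
    using flat_mem(2)[OF v] by (intro norm_dist_ge)
  then show ?thesis by (simp add: k flat_basis[OF v] ln_div)
qed

lemma finsler_dist_eq_norm_dist:
  assumes "\<eta> \<in> euclidean_norms" "\<xi> \<in> euclidean_norms"
  shows "finsler_dist \<eta> \<xi> = norm_dist \<eta> \<xi>"
proof -
  obtain v a where v: "is_basis v" and flats: "\<eta> = flat v 0" "\<xi> = flat v a"
    using euclidean_norms_common_flat[OF assms] by blast
  let ?L = "{L. \<exists>c. c 0 = \<eta> \<and> c 1 = \<xi> \<and> path_length c L}"
  have lower: "norm_dist \<eta> \<xi> \<le> L" if "L \<in> ?L" for L
    using that norm_dist_le_path_length by blast
  have mem: "infnorm a \<in> ?L"
    using path_length_flat[OF v, of a] flats by (intro CollectI exI[of _ "\<lambda>t. flat v (t *\<^sub>R a)"]) simp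
  \<comment> \<open>The general lower bound applied to this one path gives one inequality, and a
    basis vector used as test vector gives the other.\<close>
  then have "infnorm a = norm_dist \<eta> \<xi>"
    using infnorm_le_norm_dist_flat[OF v, of a] lower flats by (intro antisym) auto
  then have "Inf ?L = norm_dist \<eta> \<xi>"
    using mem lower by (intro cInf_eq_minimum) auto
  then show ?thesis using assms by (simp add: finsler_dist_def)
qed

lemma Metric_space_finsler_dist: "Metric_space euclidean_norms finsler_dist"
proof
  fix \<eta> \<xi> \<zeta> :: "real^'n \<Rightarrow> real"
  have eq: "finsler_dist \<eta> \<xi> =
      (if \<eta> \<in> euclidean_norms \<and> \<xi> \<in> euclidean_norms then norm_dist \<eta> \<xi> else 0)"
    for \<eta> \<xi> :: "real^'n \<Rightarrow> real"
    using finsler_dist_eq_norm_dist[of \<eta> \<xi>] by (simp add: finsler_dist_def)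
  show "0 \<le> finsler_dist \<eta> \<xi>" by (simp add: eq norm_dist_nonneg)
  show "finsler_dist \<eta> \<xi> = finsler_dist \<xi> \<eta>"
    by (simp add: eq norm_dist_commute[of \<eta>] conj_commute)
  assume "\<eta> \<in> euclidean_norms" "\<xi> \<in> euclidean_norms"
  then show "finsler_dist \<eta> \<xi> = 0 \<longleftrightarrow> \<eta> = \<xi>"
    using euclidean_norms_subset norms.zero[of \<eta> \<xi>]
    by (auto simp: finsler_dist_eq_norm_dist subset_iff)
  assume "\<zeta> \<in> euclidean_norms"
  then show "finsler_dist \<eta> \<zeta> \<le> finsler_dist \<eta> \<xi> + finsler_dist \<xi> \<zeta>"
    using euclidean_norms_subset norms.triangle[of \<eta> \<xi> \<zeta>] \<open>\<eta> \<in> _\<close> \<open>\<xi> \<in> _\<close>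
    by (auto simp: finsler_dist_eq_norm_dist subset_iff)
qed

theorem theorem6:
  fixes X Xhat :: "(real^'n \<Rightarrow> real) set"
  assumes "2 \<le> CARD('n)"
    and "X = euclidean_norms"
    and "Xhat = all_norms"
  shows "injective_hull X finsler_dist (\<lambda>\<eta>. \<eta>) Xhat norm_dist \<and>
    cobounded X Xhat norm_dist \<and>
    proper_metric_space Xhat norm_dist \<and>
    isometric_action GL Xhat norm_dist GL_act \<and>
    proper_action GL_topology (Metric_space.mtopology Xhat norm_dist) GL_act \<and>
    cocompact_action GL (Metric_space.mtopology Xhat norm_dist) GL_act"
proof -
  have "injective_hull (euclidean_norms :: (real^'n \<Rightarrow> real) set) finsler_dist (\<lambda>\<eta>. \<eta>)
      all_norms norm_dist"
    unfolding injective_hull_def image_ident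
    by (intro conjI Metric_space_finsler_dist injective_metric_space_all_norms
        euclidean_norms_subset ballI finsler_dist_eq_norm_dist[symmetric] allI impI
        injective_metric_space_norms_minimal) auto
  then show ?thesis
    unfolding assms(2,3)
    by (intro conjI cobounded_euclidean_norms[OF euclidean_norms_subset]
        proper_metric_space_all_norms isometric_action_GL proper_action_GL cocompact_action_GL)
qed

end
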